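(* Let $n\in\mathbb{Z}\setminus\{0\}$, $a\in\mathbb{C}\setminus\{0\}$, let $M=M(h,c)$ be the Verma module of highest weight $(h,c)\in\mathbb{C}^2$ over $\mathrm{Vir}$, and let $\delta:M\to M$ be a linear map. Then $(M,\delta)$ is a $1$-differential module over $(\mathrm{Vir},d_{n,a})$ if and only if $n>0$, $(n-1)c=0$, $(1-n)h\in\mathbb{Z}_+$ and there exists an $n$-singular vector $u\in M_{(n-1)h}$ such that $$\delta(L_{i_1}\cdots L_{i_m}v_0)=\frac{a^{i_1+\cdots+i_m}}{n^m}L_{ni_1}\cdots L_{ni_m}u-L_{i_1}\cdots L_{i_m}v_0$$ for all $i_1\le i_2\le\cdots\le i_m\le-1$. In particular, if $n=1$, there exists $\xi\in\mathbb{C}$ such that $\delta(v)=(\xi a^{-i}-1)v$ for all $v\in M_{-i}$.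
   Context: All spaces and algebras are over $\mathbb{C}$ and all linear maps are $\mathbb{C}$-linear; $\mathbb{Z}_+$ is the set of nonnegative integers and $\mathbb{N}$ the set of positive integers. For a Lie algebra $\mathcal{L}$, a $1$-differential operator on $\mathcal{L}$ is a linear map $d:\mathcal{L}\to\mathcal{L}$ such that $d[x,y]=[d(x),y]+[x,d(y)]+[d(x),d(y)]$ for all $x,y\in\mathcal{L}$. A $1$-differential module over $(\mathcal{L},d)$ is a pair $(V,\delta)$ where $V$ is an $\mathcal{L}$-module and $\delta:V\to V$ is a linear map with $\delta(xv)=d(x)v+x\delta(v)+d(x)\delta(v)$ for all $x\in\mathcal{L}$, $v\in V$. (The map $\delta=-\mathrm{id}_V$ always satisfies this; it is called the trivial $1$-differential module structure.) The Virasoro algebra $\mathrm{Vir}$ is the complex Lie algebra with basis $\{L_n, C \mid n\in\mathbb{Z}\}$ and brackets $[L_m,L_n]=(n-m)L_{n+m}+\delta_{n,-m}\frac{m^3-m}{12}C$, $[C,L_m]=0$. For $n\in\mathbb{Z}\setminus\{0\}$, $a\in\mathbb{C}\setminus\{0\}$ the $1$-differential operator $d_{n,a}$ on $\mathrm{Vir}$ is given by $d_{n,a}(L_i)=\frac{a^i}{n}\left(L_{ni}-\delta_{i,0}\frac{n^2-1}{24}C\right)-L_i$ and $d_{n,a}(C)=nC-C$. Let $\mathrm{Vir}_+$ be the span of $L_i$, $i\in\mathbb{N}$. For $h,c\in\mathbb{C}$ let $\mathbb{C}v_0$ be the $1$-dimensional module over $\mathrm{Vir}_+\oplus\mathbb{C}L_0\oplus\mathbb{C}C$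 with $L_0v_0=hv_0$, $Cv_0=cv_0$, $L_iv_0=0$ for $i>0$. The Verma module of highest weight $(h,c)$ is the induced $\mathrm{Vir}$-module $M(h,c)=U(\mathrm{Vir})\otimes_{U(\mathrm{Vir}_+\oplus\mathbb{C}L_0\oplus\mathbb{C}C)}\mathbb{C}v_0$. It has basis $L_{-i_1}\cdots L_{-i_m}v_0$ with $i_1\ge\cdots\ge i_m\ge1$ (including $v_0$ itself, the case $m=0$), and weight decomposition $M=\bigoplus_{i\in\mathbb{Z}}M_{-i}$, where $M_{-i}=\{v\in M\mid L_0v=(h-i)v,\ Cv=cv\}$. An $n$-singular vector is a nonzero weight vector $v\in M_{-i}$, $i\in\mathbb{Z}_+$, such that $L_{nj}v=0$ for all $j\in\mathbb{N}$.
   Formalization: The equivalence is stated for non-trivial structures, δ ≠ −id: the trivial structure δ = −id is always a 1-differential module, but it would force u = δ(v₀)+v₀ = 0, which is not an n-singular vector. *)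

theory Defs
  imports Complex_Main "HOL-Library.FuncSet" "HOL-Library.Poly_Mapping"
begin

class complex_vs = ab_group_add +
  fixes scaleC :: "complex \<Rightarrow> 'a \<Rightarrow> 'a"  (infixr \<open>*\<^sub>C\<close> 75)
  assumes scaleC_add_right: "c *\<^sub>C (x + y) = c *\<^sub>C x + c *\<^sub>C y"
    and scaleC_add_left: "(c + d) *\<^sub>C x = c *\<^sub>C x + d *\<^sub>C x"
    and scaleC_scaleC: "c *\<^sub>C d *\<^sub>C x = (c * d) *\<^sub>C x"
    and scaleC_one: "1 *\<^sub>C x = x"

interpretation cvs: vector_space "scaleC :: complex \<Rightarrow> 'a::complex_vs \<Rightarrow> 'a"
  by unfold_locales (simp_all add: scaleC_add_right scaleC_add_left scaleC_scaleC scaleC_one)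

class complex_lie_algebra = complex_vs +
  fixes lie_bracket :: "'a \<Rightarrow> 'a \<Rightarrow> 'a"
  assumes lie_bracket_add_left: "lie_bracket (x + y) z = lie_bracket x z + lie_bracket y z"
    and lie_bracket_add_right: "lie_bracket x (y + z) = lie_bracket x y + lie_bracket x z"
    and lie_bracket_scale_left: "lie_bracket (c *\<^sub>C x) y = c *\<^sub>C lie_bracket x y"
    and lie_bracket_scale_right: "lie_bracket x (c *\<^sub>C y) = c *\<^sub>C lie_bracket x y"
    and lie_bracket_self: "lie_bracket x x = 0"
    and lie_jacobi: "lie_bracket x (lie_bracket y z) + lie_bracket y (lie_bracket z x)
          + lie_bracket z (lie_bracket x y) = 0"

definition one_diff_operator :: "('g::complex_lie_algebra \<Rightarrow> 'g) \<Rightarrow> bool" where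
  "one_diff_operator d \<longleftrightarrow> Vector_Spaces.linear scaleC scaleC d \<and>
     (\<forall>x y. d (lie_bracket x y)
        = lie_bracket (d x) y + lie_bracket x (d y) + lie_bracket (d x) (d y))"

instantiation complex :: complex_vs
begin
definition scaleC_complex :: "complex \<Rightarrow> complex \<Rightarrow> complex" where "scaleC_complex = (*)"
instance by standard (simp_all add: scaleC_complex_def algebra_simps)
end

instantiation poly_mapping :: (type, complex_vs) complex_vs
begin
lift_definition scaleC_poly_mapping :: "complex \<Rightarrow> ('a \<Rightarrow>\<^sub>0 'b) \<Rightarrow> 'a \<Rightarrow>\<^sub>0 'b"
  is "\<lambda>c f k. c *\<^sub>C f k"
  by (erule rev_finite_subset) auto
instance
  by standard (transfer; simp add: fun_eq_iff scaleC_add_right scaleC_add_left scaleC_scaleC scaleC_one)+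
end

text \<open>\<open>'k \<Rightarrow>\<^sub>0 complex\<close> is the space with basis \<open>Poly_Mapping.single k 1\<close>;
  \<open>lin_ext f\<close> is the linear map with \<open>Poly_Mapping.single k 1 \<mapsto> f k\<close>.\<close>

definition lin_ext :: "('k \<Rightarrow> 'v::complex_vs) \<Rightarrow> ('k \<Rightarrow>\<^sub>0 complex) \<Rightarrow> 'v" where
  "lin_ext f p = (\<Sum>k\<in>Poly_Mapping.keys p. Poly_Mapping.lookup p k *\<^sub>C f k)"

lemma lin_ext_superset:
  assumes "finite A" "Poly_Mapping.keys p \<subseteq> A"
  shows "lin_ext f p = (\<Sum>k\<in>A. Poly_Mapping.lookup p k *\<^sub>C f k)"
  unfolding lin_ext_def using assms
  by (intro sum.mono_neutral_left) (auto simp: in_keys_iff)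

lemma lin_ext_add: "lin_ext f (p + q) = lin_ext f p + lin_ext f q"
proof -
  let ?A = "Poly_Mapping.keys p \<union> Poly_Mapping.keys q"
  have "lin_ext f r = (\<Sum>k\<in>?A. Poly_Mapping.lookup r k *\<^sub>C f k)" if "r \<in> {p, q, p + q}" for r
    using that keys_add[of p q] by (intro lin_ext_superset) auto
  then show ?thesis
    by (simp add: lookup_add scaleC_add_left sum.distrib)
qed

lemma lin_ext_scale: "lin_ext f (c *\<^sub>C p) = c *\<^sub>C lin_ext f p"
proof -
  have "Poly_Mapping.keys (c *\<^sub>C p) \<subseteq> Poly_Mapping.keys p"
    by (auto simp: in_keys_iff scaleC_poly_mapping.rep_eq)
  then have "lin_ext f (c *\<^sub>C p) = (\<Sum>k\<in>Poly_Mapping.keys p. Poly_Mapping.lookup (c *\<^sub>C p) k *\<^sub>C f k)"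
    by (intro lin_ext_superset) auto
  then show ?thesis
    by (simp add: lin_ext_def cvs.scale_sum_right scaleC_poly_mapping.rep_eq scaleC_scaleC scaleC_complex_def)
qed

lemma lin_ext_single: "lin_ext f (Poly_Mapping.single k c) = c *\<^sub>C f k"
  by (simp add: lin_ext_def)

lemma lin_ext_zero: "lin_ext f 0 = 0"
  by (simp add: lin_ext_def)

lemma lin_ext_uminus: "lin_ext f (- p) = - lin_ext f p"
  using lin_ext_add[of f p "- p"] by (simp add: lin_ext_zero eq_neg_iff_add_eq_0 add.commute)

lemma lin_ext_diff: "lin_ext f (p - q) = lin_ext f p - lin_ext f q"
  using lin_ext_add[of f p "- q"] by (simp add: lin_ext_uminus)

lemma poly_mapping_add_induct [case_names single add]:
  assumes s: "\<And>k c. P (Poly_Mapping.single k c)" and a: "\<And>p q. P p \<Longrightarrow> P q \<Longrightarrow> P (p + q)"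
  shows "P (p :: 'k \<Rightarrow>\<^sub>0 'b::comm_monoid_add)"
proof (induction p rule: update_induct)
  case const
  show ?case using s[of undefined 0] by simp
next
  case (update f k b)
  have "Poly_Mapping.update k b f = f + Poly_Mapping.single k b"
    using update(1) by (intro poly_mapping_eqI)
      (auto simp: lookup_update lookup_add lookup_single in_keys_iff when_def)
  then show ?case using update s a by metis
qed

lemma scaleC_single: "c *\<^sub>C Poly_Mapping.single k b = Poly_Mapping.single k (c *\<^sub>C b)"
  by (intro poly_mapping_eqI) (simp add: scaleC_poly_mapping.rep_eq lookup_single when_def)

text \<open>\<open>Vir f z\<close> stands for \<open>(\<Sum>i. f i L\<^sub>i) + z C\<close>.\<close>

datatype vir = Vir (Lpart: "int \<Rightarrow>\<^sub>0 complex") (Cpart: complex)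

instantiation vir :: complex_vs
begin
definition "0 = Vir 0 0"
definition "x + y = Vir (Lpart x + Lpart y) (Cpart x + Cpart y)"
definition "- x = Vir (- Lpart x) (- Cpart x)"
definition "x - y = Vir (Lpart x - Lpart y) (Cpart x - Cpart y)"
definition "c *\<^sub>C x = Vir (c *\<^sub>C Lpart x) (c * Cpart x)"
instance
  by standard (auto simp: zero_vir_def plus_vir_def uminus_vir_def minus_vir_def scaleC_vir_def
    scaleC_add_right scaleC_add_left scaleC_scaleC scaleC_one algebra_simps intro: vir.expand)
end

definition vL :: "int \<Rightarrow> vir" where "vL i = Vir (Poly_Mapping.single i 1) 0"
definition vC :: vir where "vC = Vir 0 1"

lemma vir_induct [case_names L C add]:
  assumes l: "\<And>c i. P (c *\<^sub>C vL i)" and z: "\<And>c. P (c *\<^sub>C vC)"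
    and a: "\<And>x y. P x \<Longrightarrow> P y \<Longrightarrow> P (x + y)"
  shows "P x"
proof -
  have "P (Vir f 0)" for f
  proof (induction f rule: poly_mapping_add_induct)
    case (single k c)
    then show ?case using l[of c k] by (simp add: vL_def scaleC_vir_def scaleC_single scaleC_complex_def)
  next
    case (add p q)
    then show ?case using a[of "Vir p 0" "Vir q 0"] by (simp add: plus_vir_def)
  qed
  then have "P (Vir (Lpart x) 0 + Cpart x *\<^sub>C vC)" using a z by blast
  then show ?thesis by (simp add: plus_vir_def scaleC_vir_def vC_def)
qed

instantiation vir :: complex_lie_algebra
begin

definition lie_bracket_vir :: "vir \<Rightarrow> vir \<Rightarrow> vir" where
  "lie_bracket_vir x y = lin_ext (\<lambda>m. lin_ext (\<lambda>n.
      of_int (n - m) *\<^sub>C vL (n + m)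
      + (if n = - m then (of_int (m ^ 3 - m) / 12) *\<^sub>C vC else 0)) (Lpart y)) (Lpart x)"

lemma Lpart_simps [simp]:
  "Lpart (x + y) = Lpart x + Lpart y" "Lpart (c *\<^sub>C x) = c *\<^sub>C Lpart x"
  "Lpart (vL i) = Poly_Mapping.single i 1" "Lpart vC = 0" "Lpart 0 = 0"
  "Cpart (x + y) = Cpart x + Cpart y" "Cpart (c *\<^sub>C x) = c * Cpart x"
  "Cpart (vL i) = 0" "Cpart vC = 1" "Cpart 0 = 0"
  by (simp_all add: plus_vir_def scaleC_vir_def vL_def vC_def zero_vir_def)

lemma lin_ext_fun_add: "lin_ext (\<lambda>k. f k + g k) p = lin_ext f p + lin_ext g p"
  by (simp add: lin_ext_def scaleC_add_right sum.distrib)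

lemma lin_ext_fun_scale: "lin_ext (\<lambda>k. c *\<^sub>C f k) p = c *\<^sub>C lin_ext f p"
  by (simp add: lin_ext_def cvs.scale_sum_right scaleC_scaleC mult.commute)

lemma lin_ext_fun_zero: "lin_ext (\<lambda>k. 0) p = 0"
  by (simp add: lin_ext_def)

lemma vir_bracket_bilinear:
  fixes x y z :: vir
  shows "lie_bracket (x + y) z = lie_bracket x z + lie_bracket y z"
    "lie_bracket x (y + z) = lie_bracket x y + lie_bracket x z"
    "lie_bracket (c *\<^sub>C x) y = c *\<^sub>C lie_bracket x y"
    "lie_bracket x (c *\<^sub>C y) = c *\<^sub>C lie_bracket x y"
  by (simp_all add: lie_bracket_vir_def lin_ext_add lin_ext_scale lin_ext_fun_add lin_ext_fun_scale scaleC_add_right)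

lemma vir_bracket_basis:
  "lie_bracket (vL m) (vL n) = of_int (n - m) *\<^sub>C vL (n + m)
      + (if n = - m then (of_int (m ^ 3 - m) / 12) *\<^sub>C vC else 0)"
  "lie_bracket vC x = 0" "lie_bracket x vC = 0" "lie_bracket x 0 = 0"
  by (simp_all add: lie_bracket_vir_def lin_ext_single lin_ext_zero lin_ext_fun_zero)

lemma vir_bracket_anti: "lie_bracket x y = - lie_bracket y (x::vir)"
proof (induction x rule: vir_induct)
  case (L c i)
  show ?case
  proof (induction y rule: vir_induct)
    case (L c' j)
    have "j = - i \<longleftrightarrow> i = - j" by auto
    then show ?case
      by (auto simp: vir_bracket_bilinear vir_bracket_basis scaleC_scaleC add.commute mult.commute
          scaleC_add_right simp flip: cvs.scale_minus_left) (simp_all add: algebra_simps flip: scaleC_add_left diff_divide_distrib add_divide_distrib)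
  qed (simp_all add: vir_bracket_bilinear vir_bracket_basis scaleC_add_right)
qed (simp_all add: vir_bracket_bilinear vir_bracket_basis)

lemma vir_bracket_jacobi:
  "lie_bracket x (lie_bracket y z) + lie_bracket y (lie_bracket z x)
     + lie_bracket z (lie_bracket x y) = (0::vir)"
proof (induction x rule: vir_induct)
  case (L c i)
  show ?case
  proof (induction y rule: vir_induct)
    case (L c' j)
    show ?case
    proof (induction z rule: vir_induct)
      case (L c'' k)
      have "lie_bracket (vL i) (lie_bracket (vL j) (vL k)) + lie_bracket (vL j) (lie_bracket (vL k) (vL i))
          + lie_bracket (vL k) (lie_bracket (vL i) (vL j)) = 0"
      proof -
        have *: "lie_bracket (vL i) (lie_bracket (vL j) (vL k)) =
          of_int ((k - j) * (k + j - i)) *\<^sub>C vL (i + j + k) +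
          (if i + j + k = 0 then (of_int ((k - j) * (i ^ 3 - i)) / 12) *\<^sub>C vC else 0)" for i j k
        proof -
          have "lie_bracket (vL i) (lie_bracket (vL j) (vL k))
              = of_int (k - j) *\<^sub>C lie_bracket (vL i) (vL (k + j))"
            by (simp add: vir_bracket_basis(1)[of j k] vir_bracket_bilinear vir_bracket_basis(2-4)
                del: of_int_diff)
          also have "k + j = - i \<longleftrightarrow> i + j + k = 0" by auto
          then have "of_int (k - j) *\<^sub>C lie_bracket (vL i) (vL (k + j)) = of_int (k - j) *\<^sub>C
              (of_int (k + j - i) *\<^sub>C vL (i + j + k) +
               (if i + j + k = 0 then (of_int (i ^ 3 - i) / 12) *\<^sub>C vC else 0))"
            by (simp only: vir_bracket_basis(1)[of i "k + j"]) (simp only: ac_simps)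
          finally show ?thesis by (simp add: scaleC_add_right scaleC_scaleC)
        qed
        have i1: "j + k + i = i + j + k" "k + i + j = i + j + k" by auto
        have a: "of_int ((k - j) * (k + j - i)) + of_int ((i - k) * (i + k - j))
            + of_int ((j - i) * (j + i - k)) = (0::complex)"
          by (simp flip: of_int_add add: algebra_simps)
        show ?thesis
        proof (cases "i + j + k = 0")
          case False
          then show ?thesis using a by (simp add: * i1 flip: scaleC_add_left)
        next
          case True
          then have k: "k = - i - j" by simp
          have b: "of_int ((k - j) * (i ^ 3 - i)) / 12 + of_int ((i - k) * (j ^ 3 - j)) / 12
            + of_int ((j - i) * (k ^ 3 - k)) / 12 = (0::complex)"
            unfolding k
            by (simp add: field_simps power3_eq_cube)
          let ?a = "of_int ((k - j) * (k + j - i)) :: complex"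
          let ?a' = "of_int ((i - k) * (i + k - j)) :: complex"
          let ?a'' = "of_int ((j - i) * (j + i - k)) :: complex"
          let ?b = "of_int ((k - j) * (i ^ 3 - i)) / 12 :: complex"
          let ?b' = "of_int ((i - k) * (j ^ 3 - j)) / 12 :: complex"
          let ?b'' = "of_int ((j - i) * (k ^ 3 - k)) / 12 :: complex"
          have "lie_bracket (vL i) (lie_bracket (vL j) (vL k)) + lie_bracket (vL j) (lie_bracket (vL k) (vL i))
          + lie_bracket (vL k) (lie_bracket (vL i) (vL j)) =
            (?a + ?a' + ?a'') *\<^sub>C vL (i + j + k) + (?b + ?b' + ?b'') *\<^sub>C vC"
            unfolding * i1 using True by (simp only: scaleC_add_left simp_thms if_True) (simp only: ac_simps)
          then show ?thesis unfolding a b by simp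
        qed
      qed
      then have "c *\<^sub>C c' *\<^sub>C c'' *\<^sub>C (lie_bracket (vL i) (lie_bracket (vL j) (vL k))
          + lie_bracket (vL j) (lie_bracket (vL k) (vL i))
          + lie_bracket (vL k) (lie_bracket (vL i) (vL j))) = 0" by simp
      then show ?case
        by (simp add: vir_bracket_bilinear scaleC_add_right scaleC_scaleC mult_ac)
    next
      case (add x y)
      then show ?case by (simp add: vir_bracket_bilinear add_eq_0_iff2) (simp add: algebra_simps)
    qed (simp_all add: vir_bracket_bilinear vir_bracket_basis)
  next
    case (add x y)
    then show ?case by (simp add: vir_bracket_bilinear add_eq_0_iff2) (simp add: algebra_simps)
  qed (simp_all add: vir_bracket_bilinear vir_bracket_basis)
next
  case (add x y)
  then show ?case by (simp add: vir_bracket_bilinear add_eq_0_iff2) (simp add: algebra_simps)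
qed (simp_all add: vir_bracket_bilinear vir_bracket_basis)

instance
proof
  fix x y z :: vir
  have "lie_bracket x x + lie_bracket x x = 0"
    using vir_bracket_anti[of x x] by (simp add: eq_neg_iff_add_eq_0)
  then have "2 *\<^sub>C lie_bracket x x = 0"
    using scaleC_add_left[of 1 1 "lie_bracket x x"] by (simp add: scaleC_one)
  then show "lie_bracket x x = 0" by simp
qed (fact vir_bracket_bilinear vir_bracket_jacobi)+

end

definition d_vir :: "int \<Rightarrow> complex \<Rightarrow> vir \<Rightarrow> vir" where
  "d_vir n a x =
     lin_ext (\<lambda>i. (a powi i / of_int n) *\<^sub>C
         (vL (n * i) - (if i = 0 then (of_int (n\<^sup>2 - 1) / 24) *\<^sub>C vC else 0)) - vL i) (Lpart x)
     + Cpart x *\<^sub>C (of_int n *\<^sub>C vC - vC)"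


lemma d_vir_add: "d_vir n a (x + y) = d_vir n a x + d_vir n a y"
  by (simp add: d_vir_def lin_ext_add scaleC_add_left algebra_simps)

lemma d_vir_scale: "d_vir n a (c *\<^sub>C x) = c *\<^sub>C d_vir n a x"
  by (simp add: d_vir_def lin_ext_scale scaleC_add_right scaleC_scaleC)

lemma d_vir_L: "d_vir n a (vL i) = (a powi i / of_int n) *\<^sub>C
    (vL (n * i) - (if i = 0 then (of_int (n\<^sup>2 - 1) / 24) *\<^sub>C vC else 0)) - vL i"
  by (simp add: d_vir_def lin_ext_single scaleC_one)

lemma d_vir_C: "d_vir n a vC = of_int n *\<^sub>C vC - vC"
  by (simp add: d_vir_def lin_ext_zero scaleC_one)

lemma d_vir_linear: "Vector_Spaces.linear scaleC scaleC (d_vir n a)"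
  by unfold_locales (simp_all add: d_vir_add d_vir_scale)

lemma d_vir_one_diff_operator:
  assumes "n \<noteq> 0" "a \<noteq> 0"
  shows "one_diff_operator (d_vir n a)"
proof -
  define D where "D x = d_vir n a x + x" for x
  have D_add: "D (x + y) = D x + D y" and D_scale: "D (c *\<^sub>C x) = c *\<^sub>C D x" for x y c
    by (simp_all add: D_def d_vir_add d_vir_scale scaleC_add_right)
  have D_L: "D (vL i) = (a powi i / of_int n) *\<^sub>C vL (n * i) +
      (if i = 0 then (- of_int (n\<^sup>2 - 1) / (24 * of_int n)) *\<^sub>C vC else 0)" for i
    by (simp add: D_def d_vir_L cvs.scale_right_diff_distrib scaleC_scaleC del: of_int_diff)
  have D_C: "D vC = of_int n *\<^sub>C vC"
    by (simp add: D_def d_vir_C)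
  have z: "D 0 = 0" "lie_bracket 0 x = 0" for x :: vir
    using D_scale[of 0 0] vir_bracket_bilinear(3)[of 0 0 x] by simp_all
  have D_bracket_L: "D (lie_bracket (vL i) (vL j)) = lie_bracket (D (vL i)) (D (vL j))" for i j
  proof -
    have "lie_bracket (D (vL i)) (D (vL j)) =
        ((a powi i / of_int n) * (a powi j / of_int n)) *\<^sub>C lie_bracket (vL (n * i)) (vL (n * j))"
    proof -
      obtain z where z: "D (vL i) = (a powi i / of_int n) *\<^sub>C vL (n * i) + z i *\<^sub>C vC" for i
      proof
        show "D (vL i) = (a powi i / of_int n) *\<^sub>C vL (n * i) +
          (if i = 0 then - of_int (n\<^sup>2 - 1) / (24 * of_int n) else 0) *\<^sub>C vC" for i
          by (simp add: D_L)
      qed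
      show ?thesis
        unfolding z by (simp add: vir_bracket_bilinear vir_bracket_basis(2-4) scaleC_scaleC)
    qed
    also have "\<dots> = ((a powi i / of_int n) * (a powi j / of_int n) * of_int (n * j - n * i)) *\<^sub>C vL (n * (j + i))
       + (if j = - i then ((a powi i / of_int n) * (a powi j / of_int n)
              * (of_int ((n * i) ^ 3 - n * i) / 12)) *\<^sub>C vC else 0)"
    proof -
      have "n * j = - (n * i) \<longleftrightarrow> j = - i" using assms(1)
        by (metis mult_cancel_left mult_minus_right)
      then show ?thesis
        by (simp add: vir_bracket_basis(1) scaleC_add_right scaleC_scaleC distrib_left del: of_int_diff of_int_mult of_int_power)
    qed
    also have "(a powi i / of_int n) * (a powi j / of_int n) * of_int (n * j - n * i)
        = of_int (j - i) * (a powi (j + i) / of_int n)"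
      using assms by (simp add: power_int_add field_simps)
    finally have 1: "lie_bracket (D (vL i)) (D (vL j)) =
       (of_int (j - i) * (a powi (j + i) / of_int n)) *\<^sub>C vL (n * (j + i))
       + (if j = - i then ((a powi i / of_int n) * (a powi j / of_int n)
              * (of_int ((n * i) ^ 3 - n * i) / 12)) *\<^sub>C vC else 0)" .
    have 2: "D (lie_bracket (vL i) (vL j)) =
       (of_int (j - i) * (a powi (j + i) / of_int n)) *\<^sub>C vL (n * (j + i))
       + (if j = - i then (of_int (j - i) * (- of_int (n\<^sup>2 - 1) / (24 * of_int n))
            + of_int (i ^ 3 - i) / 12 * of_int n) *\<^sub>C vC else 0)"
      unfolding vir_bracket_basis(1)
      by (simp add: D_add D_scale D_L D_C z(1) scaleC_add_right scaleC_add_left scaleC_scaleC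
          del: of_int_diff of_int_mult of_int_power)
    have "of_int (j - i) * (- of_int (n\<^sup>2 - 1) / (24 * of_int n))
            + of_int (i ^ 3 - i) / 12 * of_int n = (a powi i / of_int n) * (a powi j / of_int n)
              * (of_int ((n * i) ^ 3 - n * i) / 12)" if "j = - i"
    proof -
      have "a powi i * a powi j = 1" using that assms
        by (simp add: power_int_minus)
      then have "(a powi i / of_int n) * (a powi j / of_int n) = 1 / (of_int n * of_int n)"
        by (simp add: field_simps)
      then show ?thesis using that assms(1)
        by (simp add: field_simps power2_eq_square power3_eq_cube)
    qed
    then show ?thesis unfolding 1 2 by simp
  qed
  have "D (lie_bracket x y) = lie_bracket (D x) (D y)" for x y
  proof (induction x rule: vir_induct)
    case (L c i)
    show ?case
    proof (induction y rule: vir_induct)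
      case (L c' j)
      then show ?case by (simp add: vir_bracket_bilinear D_scale D_bracket_L)
    qed (auto simp: vir_bracket_bilinear vir_bracket_basis(2-4) D_add D_scale z D_C scaleC_add_right)
  qed (simp_all add: vir_bracket_bilinear vir_bracket_basis(2-4) D_add D_scale z D_C)
  then have "d_vir n a (lie_bracket x y) = lie_bracket (d_vir n a x + x) (d_vir n a y + y) - lie_bracket x y" for x y
    unfolding D_def by (metis add_diff_cancel)
  then show ?thesis
    by (simp add: one_diff_operator_def d_vir_linear vir_bracket_bilinear)
qed

datatype 'a fword = Fword "'a list"

instantiation fword :: (type) monoid_add
begin
definition "0 = Fword []"
fun plus_fword :: "'a fword \<Rightarrow> 'a fword \<Rightarrow> 'a fword" where
  "Fword xs + Fword ys = Fword (xs @ ys)"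
instance
proof
  fix a b c :: "'a fword"
  show "a + b + c = a + (b + c)" by (cases a; cases b; cases c) simp
  show "0 + a = a" "a + 0 = a" by (cases a; simp add: zero_fword_def)+
qed
end

text \<open>The free associative algebra on the set \<open>'g\<close>, whose product is the convolution product of
  \<^theory>\<open>HOL-Library.Poly_Mapping\<close>. Linearity of \<open>'g \<Rightarrow> U('g)\<close> is imposed by the first two
  families of relations, so that the quotient by these alone is the tensor algebra.\<close>

type_synonym 'g free_alg = "'g fword \<Rightarrow>\<^sub>0 complex"

definition free_gen :: "'g \<Rightarrow> 'g free_alg" where
  "free_gen x = Poly_Mapping.single (Fword [x]) 1"

definition uea_relations :: "'g::complex_lie_algebra free_alg set" where
  "uea_relations =
     {free_gen (x + y) - free_gen x - free_gen y | x y. True} \<union>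
     {free_gen (c *\<^sub>C x) - c *\<^sub>C free_gen x | c x. True} \<union>
     {free_gen x * free_gen y - free_gen y * free_gen x - free_gen (lie_bracket x y) | x y. True}"

inductive_set uea_ideal :: "'g::complex_lie_algebra free_alg set" where
  zero: "0 \<in> uea_ideal"
| add: "p \<in> uea_ideal \<Longrightarrow> q \<in> uea_ideal \<Longrightarrow> p + q \<in> uea_ideal"
| rel: "r \<in> uea_relations \<Longrightarrow> p * r * q \<in> uea_ideal"

lemma uea_ideal_mult: "r \<in> uea_ideal \<Longrightarrow> p * r * q \<in> uea_ideal"
proof (induction rule: uea_ideal.induct)
  case (rel r p' q')
  have "p * (p' * r * q') * q = (p * p') * r * (q' * q)" by (simp only: mult.assoc)
  then show ?case using rel by (simp add: uea_ideal.rel)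
qed (auto simp: distrib_left distrib_right intro: uea_ideal.intros)

lemma uea_ideal_uminus: "r \<in> uea_ideal \<Longrightarrow> - r \<in> uea_ideal"
  using uea_ideal_mult[of r "- 1" 1] by simp

lemma uea_ideal_diff: "r \<in> uea_ideal \<Longrightarrow> s \<in> uea_ideal \<Longrightarrow> r - s \<in> uea_ideal"
  using uea_ideal.add[of r "- s"] uea_ideal_uminus[of s] by simp

lemma scaleC_free_alg: "c *\<^sub>C (p :: 'k::monoid_add \<Rightarrow>\<^sub>0 complex) = Poly_Mapping.single 0 c * p"
proof (induction p rule: poly_mapping_add_induct)
  case (single k c)
  then show ?case by (simp add: scaleC_single mult_single scaleC_complex_def)
next
  case (add p q)
  then show ?case by (simp add: scaleC_add_right distrib_left)
qed

lemma scaleC_mult_free_alg: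
  fixes p q :: "'k::monoid_add \<Rightarrow>\<^sub>0 complex"
  shows "(c *\<^sub>C p) * q = c *\<^sub>C (p * q)" "p * (c *\<^sub>C q) = c *\<^sub>C (p * q)"
proof -
  show "(c *\<^sub>C p) * q = c *\<^sub>C (p * q)" by (simp add: scaleC_free_alg mult.assoc)
  have "p * Poly_Mapping.single 0 c = Poly_Mapping.single 0 c * p"
    by (induction p rule: poly_mapping_add_induct)
       (simp_all add: mult_single distrib_left distrib_right mult.commute)
  then show "p * (c *\<^sub>C q) = c *\<^sub>C (p * q)"
    by (simp add: scaleC_free_alg flip: mult.assoc)
qed

lemma uea_ideal_scale: "r \<in> uea_ideal \<Longrightarrow> c *\<^sub>C r \<in> uea_ideal"
  using uea_ideal_mult[of r "Poly_Mapping.single 0 c" 1] by (simp add: scaleC_free_alg)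

quotient_type (overloaded) 'g uea =
  "'g::complex_lie_algebra free_alg" / "\<lambda>p q. p - q \<in> uea_ideal"
proof (rule equivpI)
  show "reflp (\<lambda>p q :: 'g free_alg. p - q \<in> uea_ideal)"
    by (simp add: reflp_def uea_ideal.zero)
  show "symp (\<lambda>p q :: 'g free_alg. p - q \<in> uea_ideal)"
  proof (rule sympI)
    fix p q :: "'g free_alg"
    assume "p - q \<in> uea_ideal"
    then show "q - p \<in> uea_ideal" using uea_ideal_uminus[of "p - q"] by simp
  qed
  show "transp (\<lambda>p q :: 'g free_alg. p - q \<in> uea_ideal)"
  proof (rule transpI)
    fix p q r :: "'g free_alg"
    assume "p - q \<in> uea_ideal" "q - r \<in> uea_ideal"
    then have "(p - q) + (q - r) \<in> uea_ideal" by (rule uea_ideal.add)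
    then show "p - r \<in> uea_ideal" by simp
  qed
qed

instantiation uea :: (complex_lie_algebra) "{ring, one}"
begin
lift_definition zero_uea :: "'a uea" is 0 .
lift_definition one_uea :: "'a uea" is 1 .
lift_definition plus_uea :: "'a uea \<Rightarrow> 'a uea \<Rightarrow> 'a uea" is "(+)"
  by (metis add_diff_add uea_ideal.add)
lift_definition uminus_uea :: "'a uea \<Rightarrow> 'a uea" is uminus
  by (metis minus_diff_minus uea_ideal_uminus)
lift_definition minus_uea :: "'a uea \<Rightarrow> 'a uea \<Rightarrow> 'a uea" is "(-)"
proof -
  fix p q r s :: "'a free_alg"
  assume "p - q \<in> uea_ideal" "r - s \<in> uea_ideal"
  then have "(p - q) - (r - s) \<in> uea_ideal" by (rule uea_ideal_diff)
  then show "p - r - (q - s) \<in> uea_ideal" by (simp add: algebra_simps)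
qed
lift_definition times_uea :: "'a uea \<Rightarrow> 'a uea \<Rightarrow> 'a uea" is "(*)"
proof -
  fix p q r s :: "'a free_alg"
  assume "p - q \<in> uea_ideal" "r - s \<in> uea_ideal"
  then have "1 * (p - q) * r + q * (r - s) * 1 \<in> uea_ideal"
    by (intro uea_ideal.add uea_ideal_mult)
  then show "p * r - q * s \<in> uea_ideal" by (simp add: algebra_simps)
qed
instance
  by standard (transfer; simp add: algebra_simps uea_ideal.zero)+
end

instantiation uea :: (complex_lie_algebra) complex_vs
begin
lift_definition scaleC_uea :: "complex \<Rightarrow> 'a uea \<Rightarrow> 'a uea" is "scaleC"
  by (metis cvs.scale_right_diff_distrib uea_ideal_scale)
instance
  by standard (transfer; simp add: scaleC_add_right scaleC_add_left scaleC_scaleC scaleC_one uea_ideal.zero)+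
end

lemma uea_one: "1 * u = u" "u * 1 = (u :: 'g::complex_lie_algebra uea)"
  by (transfer; simp add: uea_ideal.zero)+

lemma scaleC_mult_uea:
  fixes u v :: "'g::complex_lie_algebra uea"
  shows "(c *\<^sub>C u) * v = c *\<^sub>C (u * v)" "u * (c *\<^sub>C v) = c *\<^sub>C (u * v)"
  by (transfer; simp add: scaleC_mult_free_alg uea_ideal.zero)+

lift_definition uea_inj :: "'g::complex_lie_algebra \<Rightarrow> 'g uea" is free_gen .

lemma uea_rel_in_ideal: "r \<in> uea_relations \<Longrightarrow> r \<in> uea_ideal"
  using uea_ideal.rel[of r 1 1] by simp

lemma uea_inj_add: "uea_inj (x + y) = uea_inj x + uea_inj y"
proof (transfer)
  fix x y :: 'a
  show "free_gen (x + y) - (free_gen x + free_gen y) \<in> uea_ideal"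
    unfolding diff_diff_add[symmetric] by (rule uea_rel_in_ideal) (auto simp: uea_relations_def)
qed

lemma uea_inj_scale: "uea_inj (c *\<^sub>C x) = c *\<^sub>C uea_inj x"
  by transfer (rule uea_rel_in_ideal, auto simp: uea_relations_def)

lemma uea_inj_bracket: "uea_inj (lie_bracket x y) = uea_inj x * uea_inj y - uea_inj y * uea_inj x"
proof (transfer)
  fix x y :: 'a
  have "free_gen x * free_gen y - free_gen y * free_gen x - free_gen (lie_bracket x y) \<in> uea_ideal"
    by (rule uea_rel_in_ideal) (auto simp: uea_relations_def)
  from uea_ideal_uminus[OF this]
  show "free_gen (lie_bracket x y) - (free_gen x * free_gen y - free_gen y * free_gen x) \<in> uea_ideal"
    by simp
qed

record ('g, 'v) lie_mod =
  mcarrier :: "'v set"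
  madd :: "'v \<Rightarrow> 'v \<Rightarrow> 'v"
  mzero :: 'v
  mscale :: "complex \<Rightarrow> 'v \<Rightarrow> 'v"
  mact :: "'g \<Rightarrow> 'v \<Rightarrow> 'v"

definition msub :: "('g, 'v) lie_mod \<Rightarrow> 'v \<Rightarrow> 'v \<Rightarrow> 'v" where
  "msub M v w = madd M v (mscale M (- 1) w)"

locale lie_module =
  fixes M :: "('g::complex_lie_algebra, 'v) lie_mod"
  assumes zero_closed: "mzero M \<in> mcarrier M"
    and add_closed: "\<lbrakk>u \<in> mcarrier M; v \<in> mcarrier M\<rbrakk> \<Longrightarrow> madd M u v \<in> mcarrier M"
    and scale_closed: "v \<in> mcarrier M \<Longrightarrow> mscale M c v \<in> mcarrier M"
    and act_closed: "v \<in> mcarrier M \<Longrightarrow> mact M x v \<in> mcarrier M"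
    and add_assoc: "\<lbrakk>u \<in> mcarrier M; v \<in> mcarrier M; w \<in> mcarrier M\<rbrakk>
          \<Longrightarrow> madd M (madd M u v) w = madd M u (madd M v w)"
    and add_commute: "\<lbrakk>u \<in> mcarrier M; v \<in> mcarrier M\<rbrakk> \<Longrightarrow> madd M u v = madd M v u"
    and add_zero: "v \<in> mcarrier M \<Longrightarrow> madd M v (mzero M) = v"
    and add_minus: "v \<in> mcarrier M \<Longrightarrow> madd M v (mscale M (- 1) v) = mzero M"
    and scale_add_right: "\<lbrakk>u \<in> mcarrier M; v \<in> mcarrier M\<rbrakk>
          \<Longrightarrow> mscale M c (madd M u v) = madd M (mscale M c u) (mscale M c v)"
    and scale_add_left: "v \<in> mcarrier M \<Longrightarrow> mscale M (c + d) v = madd M (mscale M c v) (mscale M d v)"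
    and scale_scale: "v \<in> mcarrier M \<Longrightarrow> mscale M c (mscale M d v) = mscale M (c * d) v"
    and scale_one: "v \<in> mcarrier M \<Longrightarrow> mscale M 1 v = v"
    and act_add_left: "v \<in> mcarrier M \<Longrightarrow> mact M (x + y) v = madd M (mact M x v) (mact M y v)"
    and act_add_right: "\<lbrakk>u \<in> mcarrier M; v \<in> mcarrier M\<rbrakk>
          \<Longrightarrow> mact M x (madd M u v) = madd M (mact M x u) (mact M x v)"
    and act_scale_left: "v \<in> mcarrier M \<Longrightarrow> mact M (c *\<^sub>C x) v = mscale M c (mact M x v)"
    and act_scale_right: "v \<in> mcarrier M \<Longrightarrow> mact M x (mscale M c v) = mscale M c (mact M x v)"
    and act_bracket: "v \<in> mcarrier M
          \<Longrightarrow> mact M (lie_bracket x y) v = msub M (mact M x (mact M y v)) (mact M y (mact M x v))"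

definition mlinear_endo :: "('g, 'v) lie_mod \<Rightarrow> ('v \<Rightarrow> 'v) \<Rightarrow> bool" where
  "mlinear_endo M f \<longleftrightarrow> f \<in> mcarrier M \<rightarrow> mcarrier M \<and>
     (\<forall>u\<in>mcarrier M. \<forall>v\<in>mcarrier M. f (madd M u v) = madd M (f u) (f v)) \<and>
     (\<forall>c. \<forall>v\<in>mcarrier M. f (mscale M c v) = mscale M c (f v))"

definition one_diff_module ::
    "('g::complex_lie_algebra \<Rightarrow> 'g) \<Rightarrow> ('g, 'v) lie_mod \<Rightarrow> ('v \<Rightarrow> 'v) \<Rightarrow> bool" where
  "one_diff_module d M \<delta> \<longleftrightarrow> lie_module M \<and> mlinear_endo M \<delta> \<and>
     (\<forall>x. \<forall>v\<in>mcarrier M. \<delta> (mact M x v)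
        = madd M (madd M (mact M (d x) v) (mact M x (\<delta> v))) (mact M (d x) (\<delta> v)))"

definition trivial_one_diff :: "('g, 'v) lie_mod \<Rightarrow> ('v \<Rightarrow> 'v) \<Rightarrow> bool" where
  "trivial_one_diff M \<delta> \<longleftrightarrow> (\<forall>v\<in>mcarrier M. \<delta> v = mscale M (- 1) v)"

text \<open>\<open>U('g) \<otimes>\<^bsub>U(B)\<^esub> W\<close> for a subalgebra \<open>B\<close> acting on \<open>W\<close> by \<open>\<rho>\<close>, as the quotient of the
  space with basis \<open>U('g) \<times> W\<close>. Since \<open>U(B)\<close> is generated as an algebra by \<open>B\<close>, balancedness over
  \<open>U(B)\<close> amounts to balancedness over \<open>B\<close>.\<close>

definition tensor_gen :: "'u \<Rightarrow> 'w \<Rightarrow> ('u \<times> 'w \<Rightarrow>\<^sub>0 complex)" where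
  "tensor_gen u w = Poly_Mapping.single (u, w) 1"

definition tensor_relations ::
    "'g::complex_lie_algebra set \<Rightarrow> ('g \<Rightarrow> 'w::complex_vs \<Rightarrow> 'w) \<Rightarrow> ('g uea \<times> 'w \<Rightarrow>\<^sub>0 complex) set" where
  "tensor_relations B \<rho> =
     {tensor_gen (u + u') w - tensor_gen u w - tensor_gen u' w | u u' w. True} \<union>
     {tensor_gen u (w + w') - tensor_gen u w - tensor_gen u w' | u w w'. True} \<union>
     {tensor_gen (c *\<^sub>C u) w - c *\<^sub>C tensor_gen u w | c u w. True} \<union>
     {tensor_gen u (c *\<^sub>C w) - c *\<^sub>C tensor_gen u w | c u w. True} \<union>
     {tensor_gen (u * uea_inj b) w - tensor_gen u (\<rho> b w) | u b w. b \<in> B}"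

definition tensor_act :: "'g::complex_lie_algebra \<Rightarrow> ('g uea \<times> 'w \<Rightarrow>\<^sub>0 complex) \<Rightarrow> ('g uea \<times> 'w \<Rightarrow>\<^sub>0 complex)" where
  "tensor_act x = lin_ext (\<lambda>(u, w). tensor_gen (uea_inj x * u) w)"

definition coset :: "'v::complex_vs set \<Rightarrow> 'v \<Rightarrow> 'v set" where
  "coset N t = {t + n | n. n \<in> N}"

definition induced_module ::
    "'g::complex_lie_algebra set \<Rightarrow> ('g \<Rightarrow> 'w::complex_vs \<Rightarrow> 'w) \<Rightarrow> ('g, ('g uea \<times> 'w \<Rightarrow>\<^sub>0 complex) set) lie_mod" where
  "induced_module B \<rho> = (let N = cvs.span (tensor_relations B \<rho>) in
     \<lparr> mcarrier = range (coset N),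
       madd = (\<lambda>S T. {s + t | s t. s \<in> S \<and> t \<in> T}),
       mzero = N,
       mscale = (\<lambda>c S. {c *\<^sub>C s + n | s n. s \<in> S \<and> n \<in> N}),
       mact = (\<lambda>x S. {tensor_act x s + n | s n. s \<in> S \<and> n \<in> N}) \<rparr>)"

lemma coset_eq_iff:
  assumes "cvs.subspace N"
  shows "coset N s = coset N t \<longleftrightarrow> s - t \<in> N"
proof
  assume "coset N s = coset N t"
  moreover have "s \<in> coset N s" using cvs.subspace_0[OF assms] by (force simp: coset_def)
  ultimately show "s - t \<in> N" by (auto simp: coset_def)
next
  have *: "coset N s \<subseteq> coset N t" if "s - t \<in> N" for s t
  proof
    fix x assume "x \<in> coset N s"
    then obtain n where n: "n \<in> N" "x = s + n" by (auto simp: coset_def)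
    then have "x = t + ((s - t) + n)" by simp
    moreover have "(s - t) + n \<in> N" using cvs.subspace_add[OF assms that n(1)] .
    ultimately show "x \<in> coset N t" unfolding coset_def by blast
  qed
  assume st: "s - t \<in> N"
  then have "t - s \<in> N" using cvs.subspace_neg[OF assms, of "s - t"] by simp
  then show "coset N s = coset N t" using * st by blast
qed

lemma coset_image:
  assumes N: "cvs.subspace N" and f: "\<And>s t. f (s + t) = f s + f t" "\<And>n. n \<in> N \<Longrightarrow> f n \<in> N"
  shows "{f s + n | s n. s \<in> coset N t \<and> n \<in> N} = coset N (f t)"
proof -
  have "f s + n = f t + (f m + n) \<and> f m + n \<in> N" if "s = t + m" "m \<in> N" "n \<in> N" for s m n
    using that f cvs.subspace_add[OF N] by (simp add: add.assoc)
  moreover have "t \<in> coset N t" using cvs.subspace_0[OF N] by (force simp: coset_def)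
  ultimately show ?thesis
    unfolding coset_def by blast
qed

lemma coset_add:
  assumes N: "cvs.subspace N"
  shows "{s + s' | s s'. s \<in> coset N t \<and> s' \<in> coset N t'} = coset N (t + t')"
proof -
  have "(t + m) + (t' + n) = (t + t') + (m + n) \<and> m + n \<in> N" if "m \<in> N" "n \<in> N" for m n
    using that cvs.subspace_add[OF N] by (simp add: algebra_simps)
  moreover have "t + t' + n = (t + n) + (t' + 0)" for n by (simp add: algebra_simps)
  ultimately show ?thesis
    unfolding coset_def using cvs.subspace_0[OF N] by blast
qed

lemma tensor_act_add: "tensor_act x (s + t) = tensor_act x s + tensor_act x t"
  by (simp add: tensor_act_def lin_ext_add)
lemma tensor_act_scale: "tensor_act x (c *\<^sub>C t) = c *\<^sub>C tensor_act x t"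
  by (simp add: tensor_act_def lin_ext_scale)
lemma tensor_act_diff: "tensor_act x (s - t) = tensor_act x s - tensor_act x t"
  by (simp add: tensor_act_def lin_ext_diff)
lemma tensor_act_gen: "tensor_act x (tensor_gen u w) = tensor_gen (uea_inj x * u) w"
  by (simp add: tensor_act_def tensor_gen_def lin_ext_single scaleC_one)

lemma tensor_act_span:
  assumes "t \<in> cvs.span (tensor_relations B \<rho>)"
  shows "tensor_act x t \<in> cvs.span (tensor_relations B \<rho>)"
  using assms
proof (induction rule: cvs.span_induct_alt)
  case base
  then show ?case by (simp add: tensor_act_def lin_ext_zero cvs.span_zero)
next
  case (step c r t)
  have "tensor_act x r \<in> tensor_relations B \<rho>"
    using step(1) unfolding tensor_relations_def
    by (elim UnE; clarsimp simp: tensor_act_diff tensor_act_gen tensor_act_scale distrib_left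
          scaleC_mult_uea mult.assoc[symmetric]; blast)
  then show ?case using step(2)
    by (simp add: tensor_act_add tensor_act_scale cvs.span_add cvs.span_scale cvs.span_base)
qed

lemma induced_module_simps:
  fixes B :: "'g::complex_lie_algebra set" and \<rho> :: "'g \<Rightarrow> 'w::complex_vs \<Rightarrow> 'w"
  defines "N \<equiv> cvs.span (tensor_relations B \<rho>)"
  shows "mcarrier (induced_module B \<rho>) = range (coset N)"
    "madd (induced_module B \<rho>) (coset N s) (coset N t) = coset N (s + t)"
    "mzero (induced_module B \<rho>) = coset N 0"
    "mscale (induced_module B \<rho>) c (coset N s) = coset N (c *\<^sub>C s)"
    "mact (induced_module B \<rho>) x (coset N s) = coset N (tensor_act x s)"
proof -
  have N: "cvs.subspace N" by (simp add: N_def)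
  show "mcarrier (induced_module B \<rho>) = range (coset N)"
    "mzero (induced_module B \<rho>) = coset N 0"
    by (simp_all add: induced_module_def Let_def N_def coset_def)
  show "madd (induced_module B \<rho>) (coset N s) (coset N t) = coset N (s + t)"
    using coset_add[OF N] by (simp add: induced_module_def Let_def N_def)
  show "mscale (induced_module B \<rho>) c (coset N s) = coset N (c *\<^sub>C s)"
    using coset_image[OF N, of "scaleC c" s]
    by (simp add: induced_module_def Let_def N_def scaleC_add_right cvs.span_scale)
  show "mact (induced_module B \<rho>) x (coset N s) = coset N (tensor_act x s)"
    using coset_image[OF N, of "tensor_act x" s]
    by (simp add: induced_module_def Let_def N_def tensor_act_add tensor_act_span)
qed

lemma tensor_gen_rel:
  fixes B :: "'g::complex_lie_algebra set" and \<rho> :: "'g \<Rightarrow> 'w::complex_vs \<Rightarrow> 'w"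
  defines "N \<equiv> cvs.span (tensor_relations B \<rho>)"
  shows "tensor_gen (u + u') w - tensor_gen u w - tensor_gen u' w \<in> N"
    "tensor_gen (c *\<^sub>C u) w - c *\<^sub>C tensor_gen u w \<in> N"
    "tensor_gen u (c *\<^sub>C w) - c *\<^sub>C tensor_gen u w \<in> N"
    "b \<in> B \<Longrightarrow> tensor_gen (u * uea_inj b) w - tensor_gen u (\<rho> b w) \<in> N"
  unfolding N_def by (rule cvs.span_base; unfold tensor_relations_def; blast)+

lemma tensor_act_rel:
  fixes B :: "'g::complex_lie_algebra set" and \<rho> :: "'g \<Rightarrow> 'w::complex_vs \<Rightarrow> 'w"
  defines "N \<equiv> cvs.span (tensor_relations B \<rho>)"
  shows "tensor_act (x + y) t - (tensor_act x t + tensor_act y t) \<in> N"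
    "tensor_act (c *\<^sub>C x) t - c *\<^sub>C tensor_act x t \<in> N"
    "tensor_act (lie_bracket x y) t
       - (tensor_act x (tensor_act y t) - tensor_act y (tensor_act x t)) \<in> N"
proof -
  have N: "cvs.subspace N" by (simp add: N_def)
  have ind: "F t \<in> N" if add: "\<And>s t. F (s + t) = F s + F t" and sc: "\<And>c t. F (c *\<^sub>C t) = c *\<^sub>C F t"
    and gen: "\<And>u w. F (tensor_gen u w) \<in> N" for F
  proof (induction t rule: poly_mapping_add_induct)
    case (single k c)
    have "Poly_Mapping.single k c = c *\<^sub>C tensor_gen (fst k) (snd k)"
      by (simp add: tensor_gen_def scaleC_single scaleC_complex_def)
    then show ?case by (simp add: sc gen cvs.subspace_scale[OF N])
  next
    case (add p q)
    then show ?case by (simp add: that(1) cvs.subspace_add[OF N])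
  qed
  note r = tensor_gen_rel[where B = B and \<rho> = \<rho>, folded N_def]
  show "tensor_act (x + y) t - (tensor_act x t + tensor_act y t) \<in> N"
    by (rule ind) (use r(1) in \<open>simp_all add: tensor_act_add tensor_act_scale tensor_act_gen
        uea_inj_add distrib_right scaleC_add_right cvs.scale_right_diff_distrib diff_diff_add\<close>)
  show "tensor_act (c *\<^sub>C x) t - c *\<^sub>C tensor_act x t \<in> N"
    by (rule ind) (use r(2) in \<open>simp_all add: tensor_act_add tensor_act_scale tensor_act_gen
        uea_inj_scale scaleC_mult_uea scaleC_add_right cvs.scale_right_diff_distrib scaleC_scaleC mult.commute\<close>)
  show "tensor_act (lie_bracket x y) t
       - (tensor_act x (tensor_act y t) - tensor_act y (tensor_act x t)) \<in> N"
  proof (rule ind)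
    fix u :: "'g uea" and w :: 'w
    let ?X = "uea_inj (lie_bracket x y) * u" and ?Y = "uea_inj y * (uea_inj x * u)"
    have "?X + ?Y = uea_inj x * (uea_inj y * u)"
      by (simp add: uea_inj_bracket left_diff_distrib mult.assoc)
    then have "- (tensor_gen (uea_inj x * (uea_inj y * u)) w - tensor_gen ?X w - tensor_gen ?Y w) \<in> N"
      using cvs.subspace_neg[OF N r(1)[of ?X ?Y w]] by simp
    then show "tensor_act (lie_bracket x y) (tensor_gen u w) -
      (tensor_act x (tensor_act y (tensor_gen u w)) - tensor_act y (tensor_act x (tensor_gen u w))) \<in> N"
      by (simp add: tensor_act_gen algebra_simps)
  qed (simp_all add: tensor_act_add tensor_act_scale cvs.scale_right_diff_distrib)
qed

lemma lie_module_induced: "lie_module (induced_module B \<rho>)"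
proof -
  let ?N = "cvs.span (tensor_relations B \<rho>)"
  have N: "cvs.subspace ?N" by simp
  note E = coset_eq_iff[OF N]
  show ?thesis
    by (rule lie_module.intro; (unfold msub_def induced_module_simps(1); elim imageE)?;
        simp add: induced_module_simps E rangeI tensor_act_rel cvs.span_zero add.assoc add.commute
          scaleC_add_right scaleC_add_left scaleC_scaleC scaleC_one tensor_act_add tensor_act_scale)
qed

definition vir_nonneg :: "vir set" where
  "vir_nonneg = cvs.span ({vL i | i. 0 \<le> i} \<union> {vC})"

definition hw_act :: "complex \<Rightarrow> complex \<Rightarrow> vir \<Rightarrow> complex \<Rightarrow> complex" where
  "hw_act h c x w = (h * Poly_Mapping.lookup (Lpart x) 0 + c * Cpart x) * w"

type_synonym verma_vec = "(vir uea \<times> complex \<Rightarrow>\<^sub>0 complex) set"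

definition verma :: "complex \<Rightarrow> complex \<Rightarrow> (vir, verma_vec) lie_mod" where
  "verma h c = induced_module vir_nonneg (hw_act h c)"

definition verma_hw :: "complex \<Rightarrow> complex \<Rightarrow> verma_vec" where
  "verma_hw h c = coset (cvs.span (tensor_relations vir_nonneg (hw_act h c))) (tensor_gen 1 1)"

lemma verma_hw_relations:
  defines "M \<equiv> \<lambda>h c. verma h c" and "v0 \<equiv> \<lambda>h c. verma_hw h c"
  shows "v0 h c \<in> mcarrier (M h c)"
    "mact (M h c) (vL 0) (v0 h c) = mscale (M h c) h (v0 h c)"
    "mact (M h c) vC (v0 h c) = mscale (M h c) c (v0 h c)"
    "i > 0 \<Longrightarrow> mact (M h c) (vL i) (v0 h c) = mzero (M h c)"
proof -
  let ?N = "cvs.span (tensor_relations vir_nonneg (hw_act h c))"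
  have N: "cvs.subspace ?N" by simp
  have *: "mact (M h c) b (v0 h c) = mscale (M h c) s (v0 h c)"
    if "b \<in> vir_nonneg" "\<And>w. hw_act h c b w = s * w" for b s
  proof -
    have "tensor_gen (1 * uea_inj b) 1 - tensor_gen 1 (s *\<^sub>C 1) \<in> ?N"
      using tensor_gen_rel(4)[OF that(1), of 1 1 "hw_act h c"] by (simp add: that(2) scaleC_complex_def)
    moreover have "tensor_gen 1 (s *\<^sub>C 1) - s *\<^sub>C tensor_gen 1 1 \<in> ?N"
      by (rule tensor_gen_rel(3))
    ultimately have "(tensor_gen (1 * uea_inj b) 1 - tensor_gen 1 (s *\<^sub>C 1))
        + (tensor_gen 1 (s *\<^sub>C 1) - s *\<^sub>C tensor_gen 1 1) \<in> ?N"
      by (rule cvs.span_add)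
    then show ?thesis
      by (simp add: M_def v0_def verma_def verma_hw_def induced_module_simps coset_eq_iff[OF N]
          tensor_act_gen uea_one)
  qed
  have b: "vC \<in> vir_nonneg" "i \<ge> 0 \<Longrightarrow> vL i \<in> vir_nonneg" for i
    unfolding vir_nonneg_def by (rule cvs.span_base; blast)+
  show "v0 h c \<in> mcarrier (M h c)"
    by (simp add: M_def v0_def verma_def verma_hw_def induced_module_simps)
  show "mact (M h c) (vL 0) (v0 h c) = mscale (M h c) h (v0 h c)"
    "mact (M h c) vC (v0 h c) = mscale (M h c) c (v0 h c)"
    by (rule *; simp add: b hw_act_def)+
  have "mscale (M h c) 0 (v0 h c) = mzero (M h c)"
    by (simp add: M_def v0_def verma_def verma_hw_def induced_module_simps)
  moreover assume "i > 0"
  ultimately show "mact (M h c) (vL i) (v0 h c) = mzero (M h c)"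
    using *[of "vL i" 0] b by (simp add: hw_act_def lookup_single)
qed

text \<open>\<open>verma_weight h c z\<close> is the space denoted \<open>M\<^sub>z\<close>, i.e. \<open>z = - i\<close> gives \<open>L\<^sub>0\<close>-eigenvalue
  \<open>h - i\<close>; the index is complex so that it may be \<open>(n - 1) h\<close>.\<close>

definition verma_weight :: "complex \<Rightarrow> complex \<Rightarrow> complex \<Rightarrow> verma_vec set" where
  "verma_weight h c z = {v \<in> mcarrier (verma h c).
     mact (verma h c) (vL 0) v = mscale (verma h c) (h + z) v \<and>
     mact (verma h c) vC v = mscale (verma h c) c v}"

definition n_singular :: "int \<Rightarrow> complex \<Rightarrow> complex \<Rightarrow> verma_vec \<Rightarrow> bool" where
  "n_singular n h c v \<longleftrightarrow> v \<noteq> mzero (verma h c) \<and>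
     (\<exists>i::nat. v \<in> verma_weight h c (- of_nat i)) \<and>
     (\<forall>j>0. mact (verma h c) (vL (n * j)) v = mzero (verma h c))"

definition vL_word :: "complex \<Rightarrow> complex \<Rightarrow> int list \<Rightarrow> verma_vec \<Rightarrow> verma_vec" where
  "vL_word h c is v = foldr (\<lambda>i. mact (verma h c) (vL i)) is v"

end

theory Submission
  imports Defs
begin

text \<open>
  Put \<open>T = \<delta> + id\<close> and \<open>D = d + id\<close>. The condition on \<open>\<delta>\<close> says exactly that
  \<open>T (x v) = D x (T v)\<close>, where \<open>D\<close> is an endomorphism of the Lie algebra \<open>Vir\<close> with
  \<open>D L\<^sub>i = (a\<^sup>i / n) L\<^sub>n\<^sub>i\<close> up to a central term for \<open>i = 0\<close>. So \<open>T\<close> is a homomorphism from \<open>M\<close> to \<open>M\<close> twisted by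
  \<open>D\<close>, it is determined by \<open>u = T v\<^sub>0\<close>, and by the universal property of \<open>M\<close> a vector \<open>u\<close> occurs
  if and only if \<open>D\<close> of the upper triangular part acts on \<open>u\<close> as the upper triangular part acts on \<open>v\<^sub>0\<close>. For \<open>u \<noteq> 0\<close>,
  that is, for nontrivial \<open>\<delta>\<close>,
  the action of \<open>C\<close> gives \<open>(n - 1) c = 0\<close>, then \<open>L\<^sub>0\<close> gives the weight \<open>n h\<close> of \<open>u\<close>, which has to be of the form
  \<open>h - i\<close>, and \<open>L\<^sub>i\<close> for \<open>i > 0\<close> gives \<open>L\<^sub>n\<^sub>i u = 0\<close>.

  It remains to exclude \<open>n < 0\<close>. Then \<open>c = 0\<close>, and \<open>u\<close> is killed by \<open>L\<^sub>-\<^sub>k\<close> for all positive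
  multiples \<open>k\<close> of \<open>\<bar>n\<bar>\<close>, while weights force \<open>L\<^sub>k u = 0\<close> for large \<open>k\<close>. Hence
  \<open>[L\<^sub>k, L\<^sub>-\<^sub>k] u = - 2 k L\<^sub>0 u\<close> vanishes, so \<open>h = 0\<close>, \<open>u\<close> is a multiple of \<open>v\<^sub>0\<close>, and \<open>L\<^sub>n v\<^sub>0 = 0\<close>.
  Applying \<open>L\<^sub>1\<close> repeatedly yields \<open>L\<^sub>-\<^sub>1 v\<^sub>0 = 0\<close> in \<open>M(0,0)\<close> (\<open>twisted_pos\<close>). This is false, because
  the free associative algebra on
  \<open>L\<^sub>-\<^sub>1, L\<^sub>-\<^sub>2, \<dots>\<close> carries operators \<open>L\<^sub>i\<close> for all \<open>i\<close> that satisfy the Witt relations modulo the ideal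
  generated by the commutation relations of the generators. These relations
  have degree at least 3 when \<open>L\<^sub>-\<^sub>k\<close> has degree \<open>k\<close>, so they do not affect the word
  \<open>L\<^sub>-\<^sub>1\<close> (\<open>verma_0_0_lower\<close>).

  Modules are handled as a vector space together with operators that satisfy the module axioms
  modulo a subspace (\<open>quotient_rep\<close>): the Verma module is given in this form, and so is the module
  on the free algebra, and calculations can use the operations of the ambient space.
\<close>

section \<open>Representations on quotient spaces\<close>

text \<open>A module over \<open>'g\<close> on the quotient of \<open>'v\<close> by \<open>K\<close>. The operators are honest linear maps on the
  ambient space; only their dependence on the Lie algebra element is required modulo \<open>K\<close>, since
  \<open>tensor_act\<close> is additive in that argument only on the quotient.\<close>

locale quotient_rep =
  fixes act :: "'g::complex_lie_algebra \<Rightarrow> 'v::complex_vs \<Rightarrow> 'v" and K :: "'v set"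
  assumes subspace_K: "cvs.subspace K"
    and act_add: "act x (s + t) = act x s + act x t"
    and act_scale: "act x (b *\<^sub>C t) = b *\<^sub>C act x t"
    and act_K: "t \<in> K \<Longrightarrow> act x t \<in> K"
    and add_act: "act (x + y) t - (act x t + act y t) \<in> K"
    and scale_act: "act (b *\<^sub>C x) t - b *\<^sub>C act x t \<in> K"
    and bracket_act: "act (lie_bracket x y) t - (act x (act y t) - act y (act x t)) \<in> K"
begin

definition eqv :: "'v \<Rightarrow> 'v \<Rightarrow> bool" (infix "\<approx>" 50) where
  "s \<approx> t \<longleftrightarrow> s - t \<in> K"

lemma eqv_0_iff: "t \<approx> 0 \<longleftrightarrow> t \<in> K"
  by (simp add: eqv_def)

lemma eqv_refl [simp]: "t \<approx> t"
  by (simp add: eqv_def cvs.subspace_0[OF subspace_K])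

lemma eqv_sym: "s \<approx> t \<Longrightarrow> t \<approx> s"
  using cvs.subspace_neg[OF subspace_K, of "s - t"] by (simp add: eqv_def)

lemma eqv_trans [trans]: "s \<approx> t \<Longrightarrow> t \<approx> r \<Longrightarrow> s \<approx> r"
  using cvs.subspace_add[OF subspace_K, of "s - t" "t - r"] by (simp add: eqv_def)

lemma eqv_add: "s \<approx> s' \<Longrightarrow> t \<approx> t' \<Longrightarrow> s + t \<approx> s' + t'"
  using cvs.subspace_add[OF subspace_K, of "s - s'" "t - t'"]
  by (simp add: eqv_def algebra_simps)

lemma eqv_scale: "s \<approx> t \<Longrightarrow> b *\<^sub>C s \<approx> b *\<^sub>C t"
  using cvs.subspace_scale[OF subspace_K, of "s - t" b]
  by (simp add: eqv_def cvs.scale_right_diff_distrib)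

lemma eqv_diff: "s \<approx> s' \<Longrightarrow> t \<approx> t' \<Longrightarrow> s - t \<approx> s' - t'"
  using eqv_add[of s s' "(-1) *\<^sub>C t" "(-1) *\<^sub>C t'"] eqv_scale[of t t' "-1"] by simp

lemma eqv_sum: "(\<And>i. i \<in> I \<Longrightarrow> f i \<approx> g i) \<Longrightarrow> sum f I \<approx> sum g I"
  by (induction I rule: infinite_finite_induct) (auto intro: eqv_add)

lemma act_diff: "act x (s - t) = act x s - act x t"
  using act_add[of x s "(-1) *\<^sub>C t"] act_scale[of x "-1" t] by simp

lemma act_0 [simp]: "act x 0 = 0"
  using act_add[of x 0 0] by simp

lemma act_sum: "act x (sum f I) = (\<Sum>i\<in>I. act x (f i))"
  by (induction I rule: infinite_finite_induct) (auto simp: act_add)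

lemma eqv_act: "s \<approx> t \<Longrightarrow> act x s \<approx> act x t"
  using act_K[of "s - t" x] by (simp add: eqv_def act_diff)

lemma eqv_foldr_act: "s \<approx> t \<Longrightarrow> foldr act xs s \<approx> foldr act xs t"
  by (induction xs) (auto intro: eqv_act)

lemma eqv_cancel_scale: "b *\<^sub>C t \<approx> 0 \<Longrightarrow> b \<noteq> 0 \<Longrightarrow> t \<approx> 0"
  using eqv_scale[of "b *\<^sub>C t" 0 "1 / b"] by simp

lemma eqv_add_cancel: "s \<approx> r + t \<Longrightarrow> s \<approx> 0 \<Longrightarrow> r \<approx> 0 \<Longrightarrow> t \<approx> 0"
  using eqv_diff[of "r + t" 0 r 0] by (auto intro: eqv_trans[OF eqv_sym])

lemma subspace_eqv: "cvs.subspace A \<Longrightarrow> K \<subseteq> A \<Longrightarrow> s \<approx> t \<Longrightarrow> t \<in> A \<Longrightarrow> s \<in> A"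
  using cvs.subspace_add[of A "s - t" t] by (auto simp: eqv_def)

lemma eqv_add_act: "act (x + y) t \<approx> act x t + act y t"
  and eqv_scale_act: "act (b *\<^sub>C x) t \<approx> b *\<^sub>C act x t"
  and eqv_bracket_act: "act (lie_bracket x y) t \<approx> act x (act y t) - act y (act x t)"
  by (simp_all add: eqv_def add_act scale_act bracket_act)

lemma eqv_commute: "act x (act y t) \<approx> act y (act x t) + act (lie_bracket x y) t"
  using eqv_add[OF eqv_refl[of "act y (act x t)"] eqv_bracket_act[of x y t, THEN eqv_sym]]
  by (auto intro: eqv_sym)

lemma eqv_zero_act: "act 0 t \<approx> 0"
  using eqv_scale_act[of 0 0 t] by simp

lemma foldr_act_add: "foldr act xs (s + t) = foldr act xs s + foldr act xs t"
  and foldr_act_scale: "foldr act xs (b *\<^sub>C t) = b *\<^sub>C foldr act xs t"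
  by (induction xs) (simp_all add: act_add act_scale)


text \<open>An element of the free algebra acts on the ambient space without reference to \<open>K\<close>. The
  defining relations of the enveloping algebra map the ambient space into \<open>K\<close>, which gives an action of the enveloping algebra on
  the quotient.\<close>

definition eval :: "'g free_alg \<Rightarrow> 'v \<Rightarrow> 'v" where
  "eval p t = lin_ext (\<lambda>w. case w of Fword xs \<Rightarrow> foldr act xs t) p"

lemma eval_single: "eval (Poly_Mapping.single (Fword xs) b) t = b *\<^sub>C foldr act xs t"
  by (simp add: eval_def lin_ext_single)

lemma eval_linear:
  "eval (p + q) t = eval p t + eval q t" "eval (p - q) t = eval p t - eval q t"
  "eval (b *\<^sub>C p) t = b *\<^sub>C eval p t" "eval 0 t = 0"
  by (simp_all add: eval_def lin_ext_add lin_ext_diff lin_ext_scale lin_ext_zero)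

lemma eval_linear_right:
  "eval p (s + t) = eval p s + eval p t" "eval p (b *\<^sub>C t) = b *\<^sub>C eval p t"
proof -
  have "(\<lambda>w. case w of Fword xs \<Rightarrow> foldr act xs (s + t))
      = (\<lambda>w. (case w of Fword xs \<Rightarrow> foldr act xs s) + (case w of Fword xs \<Rightarrow> foldr act xs t))"
    by (auto simp: fun_eq_iff foldr_act_add split: fword.split)
  then show "eval p (s + t) = eval p s + eval p t"
    by (simp add: eval_def lin_ext_fun_add)
  have "(\<lambda>w. case w of Fword xs \<Rightarrow> foldr act xs (b *\<^sub>C t))
      = (\<lambda>w. b *\<^sub>C (case w of Fword xs \<Rightarrow> foldr act xs t))"
    by (auto simp: fun_eq_iff foldr_act_scale split: fword.split)
  then show "eval p (b *\<^sub>C t) = b *\<^sub>C eval p t"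
    by (simp add: eval_def lin_ext_fun_scale)
qed

lemma eval_mult: "eval (p * q) t = eval p (eval q t)"
proof (induction p rule: poly_mapping_add_induct)
  case (single k b)
  show ?case
  proof (induction q rule: poly_mapping_add_induct)
    case (single l b')
    then show ?case
      by (cases k; cases l) (simp add: mult_single eval_single foldr_act_scale scaleC_scaleC)
  qed (simp add: distrib_left eval_linear eval_linear_right)
qed (simp add: distrib_right eval_linear)

lemma eval_gen: "eval (free_gen x) t = act x t"
  by (simp add: free_gen_def eval_single scaleC_one)

lemma eval_K: "t \<in> K \<Longrightarrow> eval p t \<in> K"
proof (induction p rule: poly_mapping_add_induct)
  case (single w b)
  have "foldr act xs t \<in> K" for xs
    using eqv_foldr_act[of t 0 xs] single foldr_act_scale[of xs 0 0] by (simp add: eqv_0_iff)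
  then show ?case
    by (cases w) (simp add: eval_single cvs.subspace_scale[OF subspace_K])
qed (simp add: eval_linear cvs.subspace_add[OF subspace_K])

lemma eval_relation: "r \<in> uea_relations \<Longrightarrow> eval r t \<in> K"
  using add_act[of _ _ t] scale_act[of _ _ t] cvs.subspace_neg[OF subspace_K bracket_act[of _ _ t]]
  by (auto simp: uea_relations_def eval_linear eval_mult eval_gen diff_diff_add)

lemma eval_ideal: "r \<in> uea_ideal \<Longrightarrow> eval r t \<in> K"
proof (induction arbitrary: t rule: uea_ideal.induct)
  case zero
  then show ?case by (simp add: eval_linear cvs.subspace_0[OF subspace_K])
next
  case (add p q)
  then show ?case by (simp add: eval_linear cvs.subspace_add[OF subspace_K])
next
  case (rel r p q)
  then show ?case by (simp add: eval_mult eval_K eval_relation)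
qed

text \<open>A representative of a class in the enveloping algebra has to be chosen, hence \<open>uea_act\<close> has the properties of an
  action only up to \<open>\<approx>\<close>.\<close>

definition uea_act :: "'g uea \<Rightarrow> 'v \<Rightarrow> 'v" where
  "uea_act u = eval (rep_uea u)"

lemma uea_act_abs: "uea_act (abs_uea p) t \<approx> eval p t"
proof -
  have "rep_uea (abs_uea p) - p \<in> uea_ideal"
    using Quotient3_rep_abs[OF Quotient3_uea, of p] by (simp add: uea_ideal.zero)
  then show ?thesis
    using eval_ideal[of "rep_uea (abs_uea p) - p" t]
    by (simp add: uea_act_def eqv_def eval_linear)
qed

lemma uea_abs_rep: "abs_uea (rep_uea u) = u"
  by (rule Quotient3_abs_rep[OF Quotient3_uea])

lemma uea_act_add: "uea_act (u + u') t \<approx> uea_act u t + uea_act u' t"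
  using uea_act_abs[of "rep_uea u + rep_uea u'" t]
  by (simp add: plus_uea.abs_eq[symmetric] uea_abs_rep eval_linear uea_act_def)

lemma uea_act_scale: "uea_act (b *\<^sub>C u) t \<approx> b *\<^sub>C uea_act u t"
  using uea_act_abs[of "b *\<^sub>C rep_uea u" t]
  by (simp add: scaleC_uea.abs_eq[symmetric] uea_abs_rep eval_linear uea_act_def)

lemma uea_act_mult: "uea_act (u * u') t \<approx> uea_act u (uea_act u' t)"
  using uea_act_abs[of "rep_uea u * rep_uea u'" t]
  by (simp add: times_uea.abs_eq[symmetric] uea_abs_rep eval_mult uea_act_def)

lemma uea_act_one: "uea_act 1 t \<approx> t"
proof -
  have "eval 1 t = t"
    using eval_single[of "[]" 1 t] by (simp add: scaleC_one zero_fword_def[symmetric])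
  then show ?thesis
    using uea_act_abs[of 1 t] by (simp add: one_uea.abs_eq[symmetric])
qed

lemma uea_act_inj: "uea_act (uea_inj x) t \<approx> act x t"
  using uea_act_abs[of "free_gen x" t] by (simp add: uea_inj.abs_eq[symmetric] eval_gen)

lemma eqv_uea_act: "s \<approx> t \<Longrightarrow> uea_act u s \<approx> uea_act u t"
  using eval_K[of "s - t" "rep_uea u"] eval_linear_right(1)[of "rep_uea u" "s - t" t]
  by (simp add: eqv_def uea_act_def)

text \<open>The universal property of induced modules: \<open>induced_map f\<close> is the module homomorphism
  \<open>u \<otimes> w \<mapsto> u (f w)\<close>, defined before passing to quotients. It is well defined
  when \<open>f\<close> is \<open>B\<close>-equivariant, by \<open>induced_map_relations\<close>.\<close>

definition induced_map :: "('w::complex_vs \<Rightarrow> 'v) \<Rightarrow> ('g uea \<times> 'w \<Rightarrow>\<^sub>0 complex) \<Rightarrow> 'v" where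
  "induced_map f = lin_ext (\<lambda>(u, w). uea_act u (f w))"

lemma induced_map_linear:
  "induced_map f (s + t) = induced_map f s + induced_map f t"
  "induced_map f (s - t) = induced_map f s - induced_map f t"
  "induced_map f (b *\<^sub>C s) = b *\<^sub>C induced_map f s"
  "induced_map f 0 = 0"
  by (simp_all add: induced_map_def lin_ext_add lin_ext_diff lin_ext_scale lin_ext_zero)

lemma induced_map_gen: "induced_map f (tensor_gen u w) = uea_act u (f w)"
  by (simp add: induced_map_def tensor_gen_def lin_ext_single scaleC_one)

lemma induced_map_act: "induced_map f (tensor_act x t) \<approx> act x (induced_map f t)"
proof (induction t rule: poly_mapping_add_induct)
  case (single k b)
  have k: "Poly_Mapping.single k b = b *\<^sub>C tensor_gen (fst k) (snd k)"
    by (simp add: tensor_gen_def scaleC_single scaleC_complex_def)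
  show ?case
    unfolding k tensor_act_scale induced_map_linear tensor_act_gen induced_map_gen act_scale
    using uea_act_mult uea_act_inj eqv_trans eqv_scale by blast
qed (simp add: tensor_act_add induced_map_linear act_add eqv_add)

lemma induced_map_relations:
  fixes f :: "'w::complex_vs \<Rightarrow> 'v"
  assumes f_add: "\<And>w w'. f (w + w') = f w + f w'" and f_scale: "\<And>b w. f (b *\<^sub>C w) = b *\<^sub>C f w"
    and f_act: "\<And>b w. b \<in> B \<Longrightarrow> act b (f w) \<approx> f (\<rho> b w)"
    and t: "t \<in> cvs.span (tensor_relations B \<rho>)"
  shows "induced_map f t \<in> K"
  using t
proof (induction rule: cvs.span_induct_alt)
  case base
  then show ?case by (simp add: induced_map_linear cvs.subspace_0[OF subspace_K])
next
  case (step b r t)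
  have right: "uea_act u (s + t) = uea_act u s + uea_act u t"
    "uea_act u (b *\<^sub>C t) = b *\<^sub>C uea_act u t" for u s t b
    by (simp_all add: uea_act_def eval_linear_right)
  have B: "uea_act (u * uea_inj b) (f w) \<approx> uea_act u (f (\<rho> b w))" if "b \<in> B" for u b w
    using uea_act_mult[of u "uea_inj b" "f w"] uea_act_inj[of b "f w"] f_act[OF that, of w]
    by (meson eqv_trans eqv_uea_act)
  have "induced_map f r \<in> K"
    using step(1) unfolding tensor_relations_def
    using uea_act_add uea_act_scale B
    by (auto simp: induced_map_linear induced_map_gen f_add f_scale right eqv_def diff_diff_add
        cvs.subspace_0[OF subspace_K])
  then show ?case
    using step(2)
    by (simp add: induced_map_linear cvs.subspace_add[OF subspace_K] cvs.subspace_scale[OF subspace_K])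
qed

end

section \<open>Highest weight representations of the Virasoro algebra\<close>

definition neg_word :: "int list \<Rightarrow> bool" where
  "neg_word is \<longleftrightarrow> (\<forall>i\<in>set is. i \<le> - 1)"

lemma neg_word_simps [simp]: "neg_word []" "neg_word (i # is) \<longleftrightarrow> i \<le> - 1 \<and> neg_word is"
  by (simp_all add: neg_word_def)

lemma neg_word_sum: "neg_word is \<Longrightarrow> sum_list is \<le> 0"
  by (induction "is") auto

lemma neg_word_sum_0: "neg_word is \<Longrightarrow> sum_list is = 0 \<Longrightarrow> is = []"
  using neg_word_sum[of "tl is"] by (cases "is") auto

text \<open>Cyclicity is stated as an induction principle: every submodule that contains \<open>v0\<close>, pulled back to the ambient
  space, is everything.\<close>

locale highest_weight_rep = quotient_rep act K
  for act :: "vir \<Rightarrow> 'v::complex_vs \<Rightarrow> 'v" and K +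
  fixes h c :: complex and v0 :: 'v
  assumes L0_v0: "act (vL 0) v0 - h *\<^sub>C v0 \<in> K"
    and C_v0: "act vC v0 - c *\<^sub>C v0 \<in> K"
    and raise_v0: "0 < i \<Longrightarrow> act (vL i) v0 \<in> K"
    and cyclic: "\<lbrakk>cvs.subspace A; K \<subseteq> A; v0 \<in> A; \<And>x t. t \<in> A \<Longrightarrow> act x t \<in> A\<rbrakk> \<Longrightarrow> A = UNIV"
begin

lemma cyclic_basis:
  assumes A: "cvs.subspace A" "K \<subseteq> A" "v0 \<in> A"
    and L: "\<And>i t. t \<in> A \<Longrightarrow> act (vL i) t \<in> A" and C: "\<And>t. t \<in> A \<Longrightarrow> act vC t \<in> A"
  shows "A = UNIV"
proof (rule cyclic[OF A])
  fix x t assume t: "t \<in> A"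
  show "act x t \<in> A"
  proof (induction x rule: vir_induct)
    case (L b i)
    show ?case by (rule subspace_eqv[OF A(1,2) eqv_scale_act]) (intro cvs.subspace_scale[OF A(1)] assms t)
  next
    case (C b)
    show ?case by (rule subspace_eqv[OF A(1,2) eqv_scale_act]) (intro cvs.subspace_scale[OF A(1)] assms t)
  next
    case (add x y)
    then show ?case
      by (intro subspace_eqv[OF A(1,2) eqv_add_act] cvs.subspace_add[OF A(1)])
  qed
qed

text \<open>The equalizer of two maps that are linear modulo \<open>K\<close>; together with \<open>cyclic\<close> or a spanning
  set this shows that such maps agree everywhere.\<close>

lemma subspace_eqvs:
  assumes f: "\<And>s t. f (s + t) \<approx> f s + f t" "\<And>b t. f (b *\<^sub>C t) \<approx> b *\<^sub>C f t"
    and g: "\<And>s t. g (s + t) \<approx> g s + g t" "\<And>b t. g (b *\<^sub>C t) \<approx> b *\<^sub>C g t"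
  shows "cvs.subspace {t. f t \<approx> g t}"
proof -
  have "f 0 \<approx> 0" "g 0 \<approx> 0" using f(2)[of 0 0] g(2)[of 0 0] by simp_all
  then have "f 0 \<approx> g 0" by (rule eqv_trans[OF _ eqv_sym])
  moreover have "f (s + t) \<approx> g (s + t)" if "f s \<approx> g s" "f t \<approx> g t" for s t
    by (rule eqv_trans[OF f(1) eqv_trans[OF eqv_add[OF that] eqv_sym[OF g(1)]]])
  moreover have "f (b *\<^sub>C t) \<approx> g (b *\<^sub>C t)" if "f t \<approx> g t" for b t
    by (rule eqv_trans[OF f(2) eqv_trans[OF eqv_scale[OF that] eqv_sym[OF g(2)]]])
  ultimately show ?thesis by (simp add: cvs.subspace_def)
qed

lemma eqv_K: "s \<in> K \<Longrightarrow> t \<in> K \<Longrightarrow> s \<approx> t"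
  by (simp add: eqv_def cvs.subspace_diff[OF subspace_K])

lemma scale_K: "t \<in> K \<Longrightarrow> b *\<^sub>C t \<in> K"
  by (rule cvs.subspace_scale[OF subspace_K])

text \<open>\<open>C\<close> is central and acts by \<open>c\<close> on the generator \<open>v0\<close>.\<close>

lemma C_act: "act vC t \<approx> c *\<^sub>C t"
proof -
  let ?A = "{t. act vC t \<approx> c *\<^sub>C t}"
  have "?A = UNIV"
  proof (rule cyclic)
    show "cvs.subspace ?A"
      by (rule subspace_eqvs) (simp_all add: act_add act_scale scaleC_add_right scaleC_scaleC mult.commute)
    show "v0 \<in> ?A" by (simp add: eqv_def C_v0)
    have "act vC t \<approx> c *\<^sub>C t" if "t \<in> K" for t
      by (intro eqv_K act_K scale_K that)
    then show "K \<subseteq> ?A" by blast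
    fix x t assume t: "t \<in> ?A"
    have "act vC (act x t) \<approx> act x (act vC t) + act (lie_bracket vC x) t"
      by (rule eqv_commute)
    also have "\<dots> \<approx> act x (c *\<^sub>C t) + 0"
      using t by (intro eqv_add eqv_act) (simp_all add: vir_bracket_basis eqv_zero_act)
    finally show "act x t \<in> ?A" by (simp add: act_scale)
  qed
  then show ?thesis by auto
qed

lemma L_commute:
  "act (vL i) (act (vL j) t) \<approx> act (vL j) (act (vL i) t) + of_int (j - i) *\<^sub>C act (vL (i + j)) t
     + (if j = - i then of_int (i ^ 3 - i) / 12 * c else 0) *\<^sub>C t"
proof -
  define z where "z = (if j = - i then of_int (i ^ 3 - i) / 12 else 0 :: complex)"
  have b: "lie_bracket (vL i) (vL j) = of_int (j - i) *\<^sub>C vL (i + j) + z *\<^sub>C vC"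
    by (simp add: vir_bracket_basis z_def add.commute)
  have "act (lie_bracket (vL i) (vL j)) t \<approx> act (of_int (j - i) *\<^sub>C vL (i + j)) t + act (z *\<^sub>C vC) t"
    unfolding b by (rule eqv_add_act)
  also have "\<dots> \<approx> of_int (j - i) *\<^sub>C act (vL (i + j)) t + z *\<^sub>C c *\<^sub>C t"
    by (intro eqv_add eqv_scale_act eqv_trans[OF eqv_scale_act eqv_scale[OF C_act]])
  finally have "act (vL i) (act (vL j) t) \<approx> act (vL j) (act (vL i) t) +
      (of_int (j - i) *\<^sub>C act (vL (i + j)) t + z *\<^sub>C c *\<^sub>C t)"
    by (rule eqv_trans[OF eqv_commute eqv_add[OF eqv_refl]])
  moreover have z: "(if j = - i then of_int (i ^ 3 - i) / 12 * c else 0) *\<^sub>C t = z *\<^sub>C c *\<^sub>C t"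
    by (simp add: z_def scaleC_scaleC)
  ultimately show ?thesis unfolding add.assoc z by simp
qed

definition L_word :: "int list \<Rightarrow> 'v \<Rightarrow> 'v" where
  "L_word is = foldr (\<lambda>i. act (vL i)) is"

lemma L_word_simps [simp]: "L_word [] t = t" "L_word (i # is) t = act (vL i) (L_word is t)"
  by (simp_all add: L_word_def)

lemma L_word_linear:
  "L_word is (s + t) = L_word is s + L_word is t" "L_word is (b *\<^sub>C t) = b *\<^sub>C L_word is t"
  by (induction "is") (simp_all add: act_add act_scale)

lemma eqv_L_word: "s \<approx> t \<Longrightarrow> L_word is s \<approx> L_word is t"
  by (induction "is") (auto intro: eqv_act)

lemma L_weight:
  assumes "act (vL 0) t \<approx> z *\<^sub>C t"
  shows "act (vL 0) (act (vL i) t) \<approx> (z + of_int i) *\<^sub>C act (vL i) t"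
proof -
  have "act (vL 0) (act (vL i) t) \<approx> act (vL i) (act (vL 0) t) + of_int i *\<^sub>C act (vL i) t"
    using L_commute[of 0 i t] by (cases "i = 0") simp_all
  also have "\<dots> \<approx> act (vL i) (z *\<^sub>C t) + of_int i *\<^sub>C act (vL i) t"
    by (intro eqv_add eqv_act assms eqv_refl)
  finally show ?thesis by (simp add: act_scale scaleC_add_left)
qed

lemma L_word_weight: "act (vL 0) (L_word is v0) \<approx> (h + of_int (sum_list is)) *\<^sub>C L_word is v0"
proof (induction "is")
  case Nil
  then show ?case using L0_v0 by (simp add: eqv_def)
next
  case (Cons i "is")
  then show ?case using L_weight[OF Cons, of i] by (simp add: add_ac)
qed

lemma span_superset_K: "K \<subseteq> cvs.span (S \<union> K)"
  by (auto intro: cvs.span_base)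

lemma span_K: "cvs.span K = K"
  using subspace_K by (simp only: cvs.span_eq_iff)

lemma span_eqv: "s \<approx> t \<Longrightarrow> t \<in> cvs.span (S \<union> K) \<Longrightarrow> s \<in> cvs.span (S \<union> K)"
  using subspace_eqv[OF cvs.subspace_span span_superset_K] .

lemma act_span:
  assumes "t \<in> cvs.span (S \<union> K)" "\<And>s. s \<in> S \<Longrightarrow> act x s \<in> cvs.span (S' \<union> K)"
  shows "act x t \<in> cvs.span (S' \<union> K)"
  using assms(1)
proof (induction rule: cvs.span_induct_alt)
  case base
  then show ?case by (simp add: cvs.span_zero)
next
  case (step b s t)
  have "act x s \<in> cvs.span (S' \<union> K)"
    using step(1) assms(2) act_K span_superset_K[of S'] by blast
  then show ?case
    using step(2) by (simp add: act_add act_scale cvs.span_add cvs.span_scale)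
qed

text \<open>The span of the words in negative generators is a submodule: a nonnegative
  generator is commuted to the right until it meets \<open>v0\<close>, by induction on the length.\<close>

lemma neg_words_span: "cvs.span ({L_word is v0 | is. neg_word is} \<union> K) = UNIV"
proof (rule cyclic_basis)
  let ?S = "{L_word is v0 | is. neg_word is}"
  let ?A = "cvs.span (?S \<union> K)"
  have base: "L_word is v0 \<in> ?A" if "neg_word is" for "is"
    by (rule cvs.span_base) (use that in blast)
  show "cvs.subspace ?A" by (rule cvs.subspace_span)
  show "K \<subseteq> ?A" by (rule span_superset_K)
  show v0: "v0 \<in> ?A" using base[of "[]"] by (simp only: L_word_simps neg_word_simps)
  fix t assume t: "t \<in> ?A"
  show "act vC t \<in> ?A" by (intro span_eqv[OF C_act] cvs.span_scale t)
  have neg: "act (vL i) t \<in> ?A" if i: "i \<le> - 1" and t: "t \<in> ?A" for i t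
    using t
  proof (rule act_span)
    fix s assume "s \<in> ?S"
    then obtain "is" where "neg_word is" "s = L_word is v0" by blast
    then show "act (vL i) s \<in> ?A" using base[of "i # is"] i by (simp only: L_word_simps neg_word_simps)
  qed
  have word: "act (vL i) (L_word is v0) \<in> ?A" if "neg_word is" for i "is"
    using that
  proof (induction "is" arbitrary: i)
    case Nil
    consider "i \<le> -1" | "i = 0" | "0 < i" by linarith
    then show ?case
    proof cases
      case 1
      then show ?thesis unfolding L_word_simps by (intro neg v0)
    next
      case 2
      have "act (vL 0) v0 \<approx> h *\<^sub>C v0" using L0_v0 by (simp only: eqv_def)
      then show ?thesis unfolding L_word_simps 2 by (rule span_eqv) (intro cvs.span_scale v0)
    next
      case 3
      then show ?thesis unfolding L_word_simps using raise_v0 span_superset_K[of ?S] by blast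
    qed
  next
    case (Cons j "is")
    then have j: "j \<le> - 1" and "is": "neg_word is" by (simp_all only: neg_word_simps)
    note IH = Cons(1)[OF "is"]
    show ?case
      unfolding L_word_simps
      by (rule span_eqv[OF L_commute]) (intro cvs.span_add cvs.span_scale neg[OF j] IH base "is")
  qed
  show "act (vL i) t \<in> ?A" for i
    by (rule act_span[OF t]) (use word in blast)
qed

text \<open>The straightening step: moving a letter to its place in a sorted word costs only
  words of no greater length than the original sorted word. For \<open>i > j\<close> the letter \<open>i\<close> is first moved
  past the leading letter \<open>j\<close>; the induction hypothesis then bounds the error terms, and
  prepending a letter to them raises the length by at most one.\<close>

lemma insort_word:
  assumes "neg_word is" "sorted is" "i \<le> - 1"
  shows "L_word (i # is) v0 - L_word (insort i is) v0
    \<in> cvs.span ({L_word js v0 | js. neg_word js \<and> sorted js \<and> length js \<le> length is} \<union> K)"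
  using assms
proof (induction "length is" arbitrary: i "is" rule: less_induct)
  case less
  define A where "A m = cvs.span ({L_word js v0 | js. neg_word js \<and> sorted js \<and> length js \<le> m} \<union> K)" for m
  have A: "L_word js v0 \<in> A m" if "neg_word js" "sorted js" "length js \<le> m" for js m
    unfolding A_def using that by (blast intro: cvs.span_base)
  have A_mono: "A m \<subseteq> A m'" if "m \<le> m'" for m m'
    unfolding A_def using that by (intro cvs.span_mono) auto
  have neg_insort: "neg_word (insort i is)" if "neg_word is" "i \<le> -1" for i "is"
    using that by (auto simp: neg_word_def set_insort_key)
  have step: "act (vL i) t \<in> A (Suc m)" if "m < length is" "i \<le> - 1" "t \<in> A m" for i m t
    using that(3) unfolding A_def
  proof (rule act_span)
    fix s assume "s \<in> {L_word js v0 | js. neg_word js \<and> sorted js \<and> length js \<le> m}"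
    then obtain js where js: "neg_word js" "sorted js" "length js \<le> m" "s = L_word js v0" by auto
    have "L_word (i # js) v0 - L_word (insort i js) v0 \<in> A (length js)"
      using less(1)[of js i] js that by (simp add: A_def)
    then have "L_word (i # js) v0 - L_word (insort i js) v0 \<in> A (Suc m)"
      using A_mono[of "length js" "Suc m"] js(3) by auto
    moreover have "L_word (insort i js) v0 \<in> A (Suc m)"
      using js that by (intro A neg_insort) (auto simp: sorted_insort)
    ultimately have "(L_word (i # js) v0 - L_word (insort i js) v0) + L_word (insort i js) v0 \<in> A (Suc m)"
      unfolding A_def by (rule cvs.span_add)
    then show "act (vL i) s \<in> cvs.span ({L_word js v0 | js. neg_word js \<and> sorted js \<and> length js \<le> Suc m} \<union> K)"
      using js(4) by (simp add: A_def)
  qed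
  show ?case
  proof (cases "is")
    case Nil
    then show ?thesis by (simp add: cvs.span_zero)
  next
    case (Cons j js)
    show ?thesis
    proof (cases "i \<le> j")
      case True
      then show ?thesis using Cons by (simp add: cvs.span_zero)
    next
      case False
      define m where "m = length js"
      have js: "neg_word js" "sorted js" "j \<le> - 1" "m < length is" "length is = Suc m"
        using less(2,3) Cons by (auto simp: m_def)
      let ?w = "L_word js v0"
      let ?d = "L_word (i # js) v0 - L_word (insort i js) v0"
      have "?d \<in> A m" using less(1)[of js i] js less(4) by (simp add: A_def m_def)
      then have 1: "act (vL j) ?d \<in> A (Suc m)" using step[of m j] js by simp
      have 2: "act (vL (i + j)) ?w \<in> A (Suc m)"
        using js less(4) by (intro step A) (auto simp: m_def)
      have "act (vL i) (act (vL j) ?w) \<approx> act (vL j) (act (vL i) ?w) + of_int (j - i) *\<^sub>C act (vL (i + j)) ?w"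
        using L_commute[of i j ?w] js(3) less(4) by simp
      also have "\<dots> = L_word (insort i is) v0 + (act (vL j) ?d + of_int (j - i) *\<^sub>C act (vL (i + j)) ?w)"
        using False Cons by (simp add: act_diff)
      finally have "L_word (i # is) v0 - L_word (insort i is) v0
          \<approx> act (vL j) ?d + of_int (j - i) *\<^sub>C act (vL (i + j)) ?w"
        using Cons by (simp add: eqv_def algebra_simps)
      moreover have "act (vL j) ?d + of_int (j - i) *\<^sub>C act (vL (i + j)) ?w \<in> A (length is)"
        using 1 2 unfolding js(5) unfolding A_def by (intro cvs.span_add cvs.span_scale)
      ultimately show ?thesis unfolding A_def by (rule span_eqv)
    qed
  qed
qed

lemma sorted_words_span: "cvs.span ({L_word is v0 | is. neg_word is \<and> sorted is} \<union> K) = UNIV"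
proof -
  let ?S = "{L_word is v0 | is. neg_word is \<and> sorted is}"
  let ?A = "cvs.span (?S \<union> K)"
  have base: "L_word is v0 \<in> ?A" if "neg_word is" "sorted is" for "is"
    by (rule cvs.span_base) (use that in blast)
  have ins: "act (vL i) s \<in> ?A" if s: "s \<in> ?S" and i: "i \<le> - 1" for s i
  proof -
    obtain "is" where is': "neg_word is" "sorted is" "s = L_word is v0" using s by blast
    have "neg_word (insort i is)" "sorted (insort i is)"
      using is' i by (auto simp: neg_word_def set_insort_key sorted_insort)
    then have "L_word (insort i is) v0 \<in> ?A" by (rule base)
    moreover have "L_word (i # is) v0 - L_word (insort i is) v0 \<in> ?A"
      by (rule subsetD[OF cvs.span_mono insort_word[OF is'(1,2) i]]) blast
    ultimately have "(L_word (i # is) v0 - L_word (insort i is) v0) + L_word (insort i is) v0 \<in> ?A"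
      by (rule cvs.span_add[rotated])
    then show ?thesis using is'(3) by simp
  qed
  have "L_word is v0 \<in> ?A" if "neg_word is" for "is"
    using that
  proof (induction "is")
    case Nil
    show ?case by (rule base) simp_all
  next
    case (Cons i "is")
    then have "L_word is v0 \<in> ?A" "i \<le> - 1" by simp_all
    then show ?case unfolding L_word_simps by (intro act_span[OF _ ins])
  qed
  then have "{L_word is v0 | is. neg_word is} \<union> K \<subseteq> ?A"
    using span_superset_K by blast
  then have "cvs.span ({L_word is v0 | is. neg_word is} \<union> K) \<subseteq> ?A"
    by (rule cvs.span_minimal) (rule cvs.subspace_span)
  then show ?thesis unfolding neg_words_span by blast
qed

text \<open>The classical argument: \<open>x - y0\<close> kills the summand of eigenvalue \<open>y0\<close> and rescales the
  others by nonzero factors.\<close>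

lemma eigenvectors_independent:
  assumes "finite F" "\<And>z. z \<in> F \<Longrightarrow> act x (e z) \<approx> z *\<^sub>C e z" "(\<Sum>z\<in>F. e z) \<approx> 0" "y \<in> F"
  shows "e y \<approx> 0"
  using assms
proof (induction F arbitrary: e y rule: finite_induct)
  case (insert y0 F)
  have "(\<Sum>z\<in>F. (z - y0) *\<^sub>C e z) = (\<Sum>z\<in>insert y0 F. z *\<^sub>C e z) - y0 *\<^sub>C (\<Sum>z\<in>insert y0 F. e z)"
    using insert(1,2) by (simp add: cvs.scale_left_diff_distrib sum_subtractf scaleC_add_right cvs.scale_sum_right)
  also have "\<dots> \<approx> act x (\<Sum>z\<in>insert y0 F. e z) - y0 *\<^sub>C (\<Sum>z\<in>insert y0 F. e z)"
    unfolding act_sum by (intro eqv_diff eqv_sum eqv_refl eqv_sym[OF insert(4)])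
  also have "\<dots> \<approx> 0"
    using eqv_diff[OF eqv_act[OF insert(5), of x] eqv_scale[OF insert(5), of y0]] by simp
  finally have sum: "(\<Sum>z\<in>F. (z - y0) *\<^sub>C e z) \<approx> 0" .
  have F: "e z \<approx> 0" if "z \<in> F" for z
  proof -
    have "(z - y0) *\<^sub>C e z \<approx> 0"
    proof (rule insert(3)[OF _ sum that])
      fix z assume "z \<in> F"
      then show "act x ((z - y0) *\<^sub>C e z) \<approx> z *\<^sub>C (z - y0) *\<^sub>C e z"
        using eqv_scale[OF insert(4)[of z], of "z - y0"] by (simp add: act_scale scaleC_scaleC mult.commute)
    qed
    moreover have "z - y0 \<noteq> 0" using that insert(2) by auto
    ultimately show ?thesis by (rule eqv_cancel_scale)
  qed
  have "e y0 = (\<Sum>z\<in>insert y0 F. e z) - (\<Sum>z\<in>F. e z)" using insert(1,2) by simp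
  also have "\<dots> \<approx> 0 - (\<Sum>z\<in>F. 0)" by (intro eqv_diff insert(5) eqv_sum F)
  finally show ?case using F insert(6) by auto
qed simp

definition weight_words :: "complex \<Rightarrow> 'v set" where
  "weight_words z = cvs.span ({L_word is v0 | is. neg_word is \<and> h + of_int (sum_list is) = z} \<union> K)"

lemma weight_words_weight: "t \<in> weight_words z \<Longrightarrow> act (vL 0) t \<approx> z *\<^sub>C t"
  unfolding weight_words_def
proof (induction rule: cvs.span_induct_alt)
  case (step b s t)
  have "act (vL 0) s \<approx> z *\<^sub>C s" if "s \<in> K"
    by (intro eqv_K act_K scale_K that)
  then have "act (vL 0) s \<approx> z *\<^sub>C s"
    using step(1) L_word_weight by auto
  then show ?case
    using step(2) eqv_add[OF eqv_scale[of "act (vL 0) s" "z *\<^sub>C s" b]]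
    by (simp add: act_add act_scale scaleC_add_right scaleC_scaleC mult.commute)
qed simp

lemma weight_decomposition: "\<exists>F e. finite F \<and> (\<forall>z. e z \<in> weight_words z) \<and> t = (\<Sum>z\<in>F. e z)"
proof -
  have "t \<in> cvs.span ({L_word is v0 | is. neg_word is} \<union> K)" by (simp add: neg_words_span)
  then show ?thesis
  proof (induction rule: cvs.span_induct_alt)
    case base
    have "0 \<in> weight_words z" for z by (simp add: weight_words_def cvs.span_zero)
    then show ?case by (intro exI[of _ "{}"] exI[of _ "\<lambda>_. 0"]) auto
  next
    case (step b s t)
    obtain F e where F: "finite F" "\<And>z. e z \<in> weight_words z" "t = (\<Sum>z\<in>F. e z)" using step(2) by auto
    obtain z where z: "s \<in> weight_words z"
    proof -
      consider "s \<in> K" | "is" where "neg_word is" "s = L_word is v0" using step(1) by blast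
      then have "\<exists>z. s \<in> {L_word is v0 | is. neg_word is \<and> h + of_int (sum_list is) = z} \<union> K"
        by cases blast+
      then show ?thesis using that by (auto simp: weight_words_def intro: cvs.span_base)
    qed
    define e' where "e' y = (if y \<in> F then e y else 0) + (if y = z then b *\<^sub>C s else 0)" for y
    have "e' y \<in> weight_words y" for y
      using F(2)[of y] z unfolding weight_words_def e'_def
      by (auto intro: cvs.span_add cvs.span_scale cvs.span_zero)
    moreover have "(\<Sum>y\<in>insert z F. e' y) = b *\<^sub>C s + t"
    proof -
      have "(\<Sum>y\<in>insert z F. if y \<in> F then e y else 0) = t"
        unfolding F(3) using F(1) by (intro sum.mono_neutral_cong_right) auto
      then show ?thesis using F(1) by (simp add: e'_def sum.distrib add.commute del: sum.insert)
    qed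
    ultimately show ?case using F(1) by (intro exI[of _ "insert z F"] exI[of _ e']) auto
  qed
qed

text \<open>In a decomposition of \<open>t\<close> into weight vectors, subtract \<open>t\<close> from its component of weight \<open>z\<close>.
  The components then sum to zero, so each of them vanishes by independence.\<close>

lemma weight_space: "act (vL 0) t \<approx> z *\<^sub>C t \<Longrightarrow> t \<in> weight_words z"
proof -
  assume t: "act (vL 0) t \<approx> z *\<^sub>C t"
  obtain F e where F: "finite F" "\<And>y. e y \<in> weight_words y" "t = (\<Sum>y\<in>F. e y)"
    using weight_decomposition by metis
  define e' where "e' y = (if y \<in> F then e y else 0) - (if y = z then t else 0)" for y
  have 0: "0 \<in> weight_words y" for y by (simp add: weight_words_def cvs.span_zero)
  have "act (vL 0) (if y \<in> F then e y else 0) \<approx> y *\<^sub>C (if y \<in> F then e y else 0)" for y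
    by (rule weight_words_weight) (simp add: F(2) 0)
  then have "act (vL 0) (e' y) \<approx> y *\<^sub>C e' y" for y
    unfolding e'_def act_diff cvs.scale_right_diff_distrib using t by (intro eqv_diff) auto
  moreover have "(\<Sum>y\<in>insert z F. e' y) = 0"
  proof -
    have "(\<Sum>y\<in>insert z F. if y \<in> F then e y else 0) = t"
      unfolding F(3) using F(1) by (intro sum.mono_neutral_cong_right) auto
    then show ?thesis using F(1) by (simp add: e'_def sum_subtractf del: sum.insert)
  qed
  ultimately have "e' z \<approx> 0"
    using F(1) by (intro eigenvectors_independent[of "insert z F" "vL 0" e' z]) auto
  then have "t \<approx> (if z \<in> F then e z else 0)"
    using eqv_sym[of "(if z \<in> F then e z else 0)" t] by (simp add: e'_def eqv_def)
  moreover have "(if z \<in> F then e z else 0) \<in> weight_words z"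
    using F(2) 0 by simp
  ultimately show ?thesis
    unfolding weight_words_def by (rule span_eqv)
qed

text \<open>Words of negative letters lower the weight \<open>h\<close> of \<open>v0\<close> by a natural number.\<close>

lemma weight_bound:
  assumes "act (vL 0) t \<approx> z *\<^sub>C t" "\<not> t \<approx> 0"
  shows "h - z \<in> \<nat>"
proof (rule ccontr)
  assume *: "h - z \<notin> \<nat>"
  have "h + of_int (sum_list is) \<noteq> z" if "neg_word is" for "is"
  proof
    assume "h + of_int (sum_list is) = z"
    then have "h - z = of_int (- sum_list is)" by auto
    moreover have "sum_list is \<le> 0"
      using that by (rule neg_word_sum)
    ultimately have "h - z = of_nat (nat (- sum_list is))" by simp
    then show False using * by simp
  qed
  then have "{L_word is v0 | is. neg_word is \<and> h + of_int (sum_list is) = z} = {}" by blast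
  then have "t \<in> cvs.span K"
    using weight_space[OF assms(1)] unfolding weight_words_def by (simp only: Un_empty_left)
  then show False using assms(2) by (simp add: eqv_0_iff span_K)
qed

text \<open>The empty word is the only word of negative letters whose sum is zero.\<close>

lemma top_weight_space:
  assumes "act (vL 0) t \<approx> h *\<^sub>C t"
  shows "\<exists>b. t \<approx> b *\<^sub>C v0"
proof -
  have "{L_word is v0 | is. neg_word is \<and> h + of_int (sum_list is) = h} \<subseteq> {v0}"
    by (auto dest: neg_word_sum_0)
  then have "t \<in> cvs.span (insert v0 K)"
    using weight_space[OF assms] unfolding weight_words_def
    by (rule_tac subsetD[OF cvs.span_mono]) auto
  then obtain b where "t - b *\<^sub>C v0 \<in> cvs.span K" by (auto simp: cvs.span_insert)
  then show ?thesis
    by (auto simp: eqv_def span_K)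
qed

end

section \<open>Endomorphisms twisted by the operators of the Virasoro algebra\<close>

text \<open>\<open>\<tau>\<close> presents the map \<open>\<delta> + id\<close> of a \<open>1\<close>-differential module, as a map on the ambient space that is linear
  modulo \<open>K\<close>.\<close>

locale twisted_endo = highest_weight_rep act K h c v0
  for act :: "vir \<Rightarrow> 'v::complex_vs \<Rightarrow> 'v" and K h c v0 +
  fixes n :: int and a :: complex and \<tau> :: "'v \<Rightarrow> 'v"
  assumes n_nonzero: "n \<noteq> 0" and a_nonzero: "a \<noteq> 0"
    and twisted_add: "\<tau> (s + t) - (\<tau> s + \<tau> t) \<in> K"
    and twisted_scale: "\<tau> (b *\<^sub>C t) - b *\<^sub>C \<tau> t \<in> K"
    and twisted_K: "t \<in> K \<Longrightarrow> \<tau> t \<in> K"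
    and twisted_act: "\<tau> (act x t) - act (d_vir n a x + x) (\<tau> t) \<in> K"
begin

lemma eqv_twisted_add: "\<tau> (s + t) \<approx> \<tau> s + \<tau> t"
  and eqv_twisted_scale: "\<tau> (b *\<^sub>C t) \<approx> b *\<^sub>C \<tau> t"
  and eqv_twisted_act: "\<tau> (act x t) \<approx> act (d_vir n a x + x) (\<tau> t)"
  by (simp_all add: eqv_def twisted_add twisted_scale twisted_act)

lemma eqv_twisted:
  assumes "s \<approx> t"
  shows "\<tau> s \<approx> \<tau> t"
proof -
  have "\<tau> (t + (s - t)) \<approx> \<tau> t + \<tau> (s - t)" by (rule eqv_twisted_add)
  also have "\<dots> \<approx> \<tau> t + 0"
    using assms by (intro eqv_add eqv_refl) (simp add: eqv_0_iff eqv_def twisted_K)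
  finally show ?thesis by simp
qed

end

context highest_weight_rep
begin

lemma twisted_C_act: "act (d_vir n a vC + vC) t \<approx> (of_int n * c) *\<^sub>C t"
proof -
  have "d_vir n a vC + vC = of_int n *\<^sub>C vC" by (simp add: d_vir_C)
  then have "act (d_vir n a vC + vC) t \<approx> of_int n *\<^sub>C act vC t" using eqv_scale_act by simp
  also have "\<dots> \<approx> of_int n *\<^sub>C c *\<^sub>C t" by (intro eqv_scale C_act)
  finally show ?thesis by (simp add: scaleC_scaleC)
qed

lemma twisted_L_act:
  "act (d_vir n a (vL i) + vL i) t \<approx> (a powi i / of_int n) *\<^sub>C
     (act (vL (n * i)) t - (if i = 0 then of_int (n\<^sup>2 - 1) / 24 * c else 0) *\<^sub>C t)"
proof -
  define z where "z = (if i = 0 then of_int (n\<^sup>2 - 1) / 24 else 0 :: complex)"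
  have eq: "d_vir n a (vL i) + vL i = (a powi i / of_int n) *\<^sub>C (vL (n * i) + (- z) *\<^sub>C vC)"
    by (simp add: d_vir_L z_def)
  have "act (vL (n * i) + (- z) *\<^sub>C vC) t \<approx> act (vL (n * i)) t + act ((- z) *\<^sub>C vC) t"
    by (rule eqv_add_act)
  also have "\<dots> \<approx> act (vL (n * i)) t + (- z) *\<^sub>C c *\<^sub>C t"
    by (intro eqv_add eqv_refl eqv_trans[OF eqv_scale_act] eqv_scale C_act)
  also have "\<dots> = act (vL (n * i)) t - (z * c) *\<^sub>C t"
    by (simp add: scaleC_scaleC)
  finally have act_eq: "act (vL (n * i) + (- z) *\<^sub>C vC) t \<approx> act (vL (n * i)) t - (z * c) *\<^sub>C t" .
  have z: "(if i = 0 then of_int (n\<^sup>2 - 1) / 24 * c else 0) = z * c" by (simp add: z_def)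
  show ?thesis unfolding eq z by (rule eqv_trans[OF eqv_scale_act eqv_scale[OF act_eq]])
qed

lemma twisted_L_act_nonzero:
  "i \<noteq> 0 \<Longrightarrow> act (d_vir n a (vL i) + vL i) t \<approx> (a powi i / of_int n) *\<^sub>C act (vL (n * i)) t"
  using twisted_L_act[of n a i t] by simp

text \<open>The central correction in \<open>d_vir n a (vL 0)\<close> has the coefficient \<open>n\<^sup>2 - 1 = (n + 1) (n - 1)\<close> and
  disappears once \<open>(n - 1) c = 0\<close>.\<close>

lemma twisted_L0_act:
  assumes "(of_int n - 1) * c = 0"
  shows "act (d_vir n a (vL 0) + vL 0) t \<approx> (1 / of_int n) *\<^sub>C act (vL 0) t"
proof -
  have "of_int (n\<^sup>2 - 1) = (of_int n + 1) * (of_int n - 1 :: complex)"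
    by (simp add: power2_eq_square algebra_simps)
  then have "of_int (n\<^sup>2 - 1) / 24 * c = (of_int n + 1) / 24 * ((of_int n - 1) * c)" by simp
  then have "of_int (n\<^sup>2 - 1) / 24 * c = 0" unfolding assms by simp
  then have z: "(if (0::int) = 0 then of_int (n\<^sup>2 - 1) / 24 * c else 0) = 0" by simp
  show ?thesis using twisted_L_act[of n a 0 t] unfolding z by simp
qed

text \<open>Since \<open>L\<^sub>1 v\<^sub>0 = 0\<close>, applying \<open>L\<^sub>1\<close> to \<open>L\<^sub>-\<^sub>m v\<^sub>0\<close> gives \<open>- (m + 1) L\<^sub>1\<^sub>-\<^sub>m v\<^sub>0\<close>. The central term
  would appear only for \<open>m = 1\<close>.\<close>

lemma lower_vanish_descend:
  assumes "act (vL (- int (Suc k))) v0 \<approx> 0"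
  shows "act (vL (- 1)) v0 \<approx> 0"
  using assms
proof (induction k)
  case (Suc k)
  let ?m = "- int (Suc (Suc k))"
  have "act (vL 1) (act (vL ?m) v0) \<approx> act (vL ?m) (act (vL 1) v0) + of_int (?m - 1) *\<^sub>C act (vL (1 + ?m)) v0"
    using L_commute[of 1 ?m v0] by simp
  moreover have "act (vL 1) (act (vL ?m) v0) \<approx> 0" using eqv_act[OF Suc(2), of "vL 1"] by simp
  moreover have "act (vL ?m) (act (vL 1) v0) \<approx> 0"
    using raise_v0[of 1] by (simp add: eqv_0_iff act_K)
  ultimately have "of_int (?m - 1) *\<^sub>C act (vL (1 + ?m)) v0 \<approx> 0"
    by (rule eqv_add_cancel)
  moreover have "of_int (?m - 1) \<noteq> (0 :: complex)" unfolding of_int_eq_0_iff by simp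
  ultimately have "act (vL (1 + ?m)) v0 \<approx> 0" by (rule eqv_cancel_scale)
  then show ?case using Suc(1) by (simp add: algebra_simps)
qed simp

end

context twisted_endo
begin

lemma twisted_zero:
  assumes "\<tau> v0 \<approx> 0"
  shows "\<tau> t \<approx> 0"
proof -
  have "{t. \<tau> t \<approx> 0} = UNIV"
  proof (rule cyclic)
    show "cvs.subspace {t. \<tau> t \<approx> 0}"
      by (rule subspace_eqvs) (simp_all add: eqv_twisted_add eqv_twisted_scale)
    show "K \<subseteq> {t. \<tau> t \<approx> 0}" by (auto simp: eqv_0_iff twisted_K)
    show "v0 \<in> {t. \<tau> t \<approx> 0}" using assms by simp
    fix x t assume "t \<in> {t. \<tau> t \<approx> 0}"
    then have "act (d_vir n a x + x) (\<tau> t) \<approx> 0" by (simp add: eqv_0_iff act_K)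
    then show "act x t \<in> {t. \<tau> t \<approx> 0}" using eqv_twisted_act eqv_trans by blast
  qed
  then show ?thesis by auto
qed

lemma twisted_C:
  assumes "\<not> \<tau> v0 \<approx> 0"
  shows "(of_int n - 1) * c = 0"
proof (rule ccontr)
  assume *: "(of_int n - 1) * c \<noteq> 0"
  have "c *\<^sub>C \<tau> v0 \<approx> \<tau> (act vC v0)"
    by (rule eqv_sym) (rule eqv_trans[OF eqv_twisted[OF C_act] eqv_twisted_scale])
  also have "\<dots> \<approx> (of_int n * c) *\<^sub>C \<tau> v0"
    by (rule eqv_trans[OF eqv_twisted_act twisted_C_act])
  finally have "(c - of_int n * c) *\<^sub>C \<tau> v0 \<approx> 0"
    by (simp add: eqv_def cvs.scale_left_diff_distrib)
  then have "\<tau> v0 \<approx> 0"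
    by (rule eqv_cancel_scale) (use * in \<open>auto simp: algebra_simps\<close>)
  then show False using assms by simp
qed

lemma twisted_L0:
  assumes "(of_int n - 1) * c = 0"
  shows "act (vL 0) (\<tau> v0) \<approx> (of_int n * h) *\<^sub>C \<tau> v0"
proof -
  have L0: "act (vL 0) v0 \<approx> h *\<^sub>C v0" using L0_v0 by (simp add: eqv_def)
  have "(1 / of_int n) *\<^sub>C act (vL 0) (\<tau> v0) \<approx> \<tau> (act (vL 0) v0)"
    by (rule eqv_sym) (rule eqv_trans[OF eqv_twisted_act twisted_L0_act[OF assms]])
  also have "\<dots> \<approx> h *\<^sub>C \<tau> v0"
    by (rule eqv_trans[OF eqv_twisted[OF L0] eqv_twisted_scale])
  finally show ?thesis
    using eqv_scale[of "(1 / of_int n) *\<^sub>C act (vL 0) (\<tau> v0)" "h *\<^sub>C \<tau> v0" "of_int n"] n_nonzero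
    by (simp add: scaleC_scaleC)
qed

lemma twisted_singular:
  assumes "0 < i"
  shows "act (vL (n * i)) (\<tau> v0) \<approx> 0"
proof -
  have "(a powi i / of_int n) *\<^sub>C act (vL (n * i)) (\<tau> v0) \<approx> \<tau> (act (vL i) v0)"
    by (rule eqv_sym) (rule eqv_trans[OF eqv_twisted_act twisted_L_act_nonzero], use assms in simp)
  also have "\<dots> \<approx> 0" using raise_v0[OF assms] by (simp add: eqv_0_iff twisted_K)
  finally show ?thesis
    by (rule eqv_cancel_scale) (simp add: a_nonzero n_nonzero)
qed

lemma twisted_word:
  assumes "neg_word is"
  shows "\<tau> (L_word is v0) \<approx>
    (a powi sum_list is / of_int n ^ length is) *\<^sub>C L_word (map (\<lambda>i. n * i) is) (\<tau> v0)"
  using assms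
proof (induction "is")
  case Nil
  then show ?case by simp
next
  case (Cons i "is")
  let ?w = "L_word (map (\<lambda>i. n * i) is) (\<tau> v0)"
  let ?b = "a powi sum_list is / of_int n ^ length is"
  have "\<tau> (act (vL i) (L_word is v0)) \<approx> (a powi i / of_int n) *\<^sub>C act (vL (n * i)) (\<tau> (L_word is v0))"
    by (rule eqv_trans[OF eqv_twisted_act twisted_L_act_nonzero]) (use Cons in auto)
  also have "\<dots> \<approx> (a powi i / of_int n) *\<^sub>C act (vL (n * i)) (?b *\<^sub>C ?w)"
    using Cons by (intro eqv_scale eqv_act) auto
  finally show ?case
    by (simp add: act_scale scaleC_scaleC power_int_add a_nonzero)
qed

lemma twisted_weight:
  assumes "\<not> \<tau> v0 \<approx> 0"
  shows "(1 - of_int n) * h \<in> \<nat>"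
  using weight_bound[OF twisted_L0[OF twisted_C[OF assms]] assms] by (simp add: algebra_simps)

text \<open>For \<open>n < 0\<close> the roles of raising and lowering operators are exchanged by the twist: the image
  of \<open>v0\<close> is killed by \<open>L\<^sub>-\<^sub>k\<close> for the multiples \<open>k > 0\<close> of \<open>n\<close>, and by \<open>L\<^sub>k\<close> for large \<open>k\<close>. Their commutator
  forces weight zero, and the image becomes a multiple of \<open>v0\<close>.\<close>

lemma twisted_pos:
  assumes nz: "\<not> \<tau> v0 \<approx> 0"
    and lower: "h = 0 \<Longrightarrow> c = 0 \<Longrightarrow> \<not> act (vL (- 1)) v0 \<approx> 0"
  shows "n > 0"
proof (rule ccontr)
  assume "\<not> n > 0"
  then have n: "n < 0" using n_nonzero by simp
  have "of_int n - 1 \<noteq> (0 :: complex)"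
    using n by (metis eq_iff_diff_eq_0 of_int_1 of_int_eq_iff not_one_less_zero)
  then have c: "c = 0" using twisted_C[OF nz] by simp
  have L0: "act (vL 0) (\<tau> v0) \<approx> (of_int n * h) *\<^sub>C \<tau> v0"
    by (rule twisted_L0[OF twisted_C[OF nz]])
  obtain i :: nat where i: "h - of_int n * h = of_nat i"
    using twisted_weight[OF nz] by (auto elim!: Nats_cases simp: algebra_simps)
  \<comment> \<open>a multiple of \<open>n\<close> that exceeds the depth \<open>i\<close> of the image of \<open>v0\<close>\<close>
  define k where "k = - n * (int i + 1)"
  have "1 * (int i + 1) \<le> - n * (int i + 1)" using n by (intro mult_right_mono) auto
  then have k: "int i < k" by (simp add: k_def)
  have up: "act (vL k) (\<tau> v0) \<approx> 0"
  proof (rule ccontr)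
    assume "\<not> ?thesis"
    then have "h - (of_int n * h + of_int k) \<in> \<nat>" by (rule weight_bound[OF L_weight[OF L0]])
    moreover have "h - (of_int n * h + of_int k) = of_int (int i - k)"
      unfolding diff_diff_add[symmetric] i by simp
    ultimately have "of_int (int i - k) \<in> (\<nat> :: complex set)" by (simp only:)
    then obtain m where "of_int (int i - k) = (of_nat m :: complex)" by (rule Nats_cases)
    then have "int i - k = int m" by (metis of_int_eq_iff of_int_of_nat_eq)
    then show False using k by simp
  qed
  have down: "act (vL (- k)) (\<tau> v0) \<approx> 0"
    using twisted_singular[of "int i + 1"] by (simp add: k_def)
  have "act (vL k) (act (vL (- k)) (\<tau> v0)) \<approx>
      act (vL (- k)) (act (vL k) (\<tau> v0)) + of_int (- 2 * k) *\<^sub>C act (vL 0) (\<tau> v0)"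
    using L_commute[of k "- k" "\<tau> v0"] by (simp add: c)
  moreover have "act (vL k) (act (vL (- k)) (\<tau> v0)) \<approx> 0" "act (vL (- k)) (act (vL k) (\<tau> v0)) \<approx> 0"
    using up down by (simp_all add: eqv_0_iff act_K)
  ultimately have "of_int (- 2 * k) *\<^sub>C act (vL 0) (\<tau> v0) \<approx> 0"
    by (rule eqv_add_cancel)
  moreover have "of_int (- 2 * k) \<noteq> (0 :: complex)" unfolding of_int_eq_0_iff using k by simp
  ultimately have "act (vL 0) (\<tau> v0) \<approx> 0" by (rule eqv_cancel_scale)
  then have "(of_int n * h) *\<^sub>C \<tau> v0 \<approx> 0" using L0 eqv_sym eqv_trans by blast
  then have h: "h = 0" using nz eqv_cancel_scale n_nonzero by fastforce
  then obtain b where b: "\<tau> v0 \<approx> b *\<^sub>C v0"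
    using top_weight_space[of "\<tau> v0"] L0 by auto
  then have "b \<noteq> 0" using nz by auto
  have "b *\<^sub>C act (vL n) v0 \<approx> act (vL n) (\<tau> v0)"
    using eqv_act[OF eqv_sym[OF b], of "vL n"] by (simp add: act_scale)
  also have "\<dots> \<approx> 0" using twisted_singular[of 1] by simp
  finally have "act (vL n) v0 \<approx> 0" using \<open>b \<noteq> 0\<close> by (rule eqv_cancel_scale)
  moreover have "n = - int (Suc (nat (- n - 1)))" using n by simp
  ultimately have "act (vL (- 1)) v0 \<approx> 0" using lower_vanish_descend by metis
  then show False using lower[OF h c] by simp
qed

text \<open>For \<open>n = 1\<close> the image of \<open>v0\<close> has the top weight, and the twist only rescales \<open>L\<^sub>i\<close> by \<open>a\<^sup>i\<close>.\<close>

lemma twisted_one: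
  assumes "n = 1"
  shows "\<exists>\<xi>. \<forall>i::int. \<forall>t. act (vL 0) t \<approx> (h - of_int i) *\<^sub>C t \<longrightarrow> \<tau> t \<approx> (\<xi> * a powi (- i)) *\<^sub>C t"
proof -
  have "act (vL 0) (\<tau> v0) \<approx> h *\<^sub>C \<tau> v0"
    using twisted_L0 assms by simp
  then obtain \<xi> where \<xi>: "\<tau> v0 \<approx> \<xi> *\<^sub>C v0" using top_weight_space by blast
  have word: "\<tau> (L_word is v0) \<approx> (\<xi> * a powi sum_list is) *\<^sub>C L_word is v0" if "neg_word is" for "is"
  proof -
    have "\<tau> (L_word is v0) \<approx> a powi sum_list is *\<^sub>C L_word is (\<tau> v0)"
      using twisted_word[OF that] assms by simp
    also have "\<dots> \<approx> a powi sum_list is *\<^sub>C L_word is (\<xi> *\<^sub>C v0)"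
      by (intro eqv_scale eqv_L_word \<xi>)
    finally show ?thesis by (simp add: L_word_linear scaleC_scaleC mult.commute)
  qed
  have "\<tau> t \<approx> (\<xi> * a powi (- i)) *\<^sub>C t" if "act (vL 0) t \<approx> (h - of_int i) *\<^sub>C t" for i t
  proof -
    let ?S = "{L_word is v0 | is. neg_word is \<and> h + of_int (sum_list is) = h - of_int i}"
    let ?A = "{t. \<tau> t \<approx> (\<xi> * a powi (- i)) *\<^sub>C t}"
    have "cvs.subspace ?A"
      by (rule subspace_eqvs)
        (simp_all add: eqv_twisted_add eqv_twisted_scale scaleC_add_right scaleC_scaleC mult.commute)
    moreover have "s \<in> ?A" if s: "s \<in> ?S" for s
    proof -
      obtain "is" where is': "neg_word is" "of_int (sum_list is) = (of_int (- i) :: complex)" "s = L_word is v0"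
        using s by auto
      then have "sum_list is = - i" by (simp only: of_int_eq_iff)
      then show ?thesis using word[OF is'(1)] is'(3) by simp
    qed
    moreover have "\<tau> s \<approx> (\<xi> * a powi (- i)) *\<^sub>C s" if "s \<in> K" for s
      by (rule eqv_K) (use that in \<open>auto intro: twisted_K scale_K\<close>)
    ultimately have "cvs.span (?S \<union> K) \<subseteq> ?A" by (intro cvs.span_minimal) auto
    then show ?thesis using weight_space[OF that] by (auto simp: weight_words_def)
  qed
  then show ?thesis by blast
qed

end

section \<open>The Witt algebra acting on words in its negative generators\<close>

text \<open>The letter \<open>k\<close> of a word stands for \<open>L\<^sub>-\<^sub>1\<^sub>-\<^sub>k\<close>, so \<open>[]\<close> is the highest weight vector and \<open>[0]\<close> is
  \<open>L\<^sub>-\<^sub>1\<close> applied to it. A negative generator prepends its letter, and a nonnegative one is commuted past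
  the first letter by the Witt relations. This is a recursion on the word, and no order on letters is
  imposed, so that there is nothing to check for well-definedness.\<close>

fun witt_word :: "int \<Rightarrow> nat list \<Rightarrow> (nat list \<Rightarrow>\<^sub>0 complex)" where
  "witt_word i [] = (if i < 0 then Poly_Mapping.single [nat (-1 - i)] 1 else 0)"
| "witt_word i (k # w) =
     (if i < 0 then Poly_Mapping.single (nat (-1 - i) # k # w) 1
      else lin_ext (\<lambda>w'. Poly_Mapping.single (k # w') 1) (witt_word i w)
        + of_int (-1 - int k - i) *\<^sub>C witt_word (i - 1 - int k) w)"

definition witt :: "int \<Rightarrow> (nat list \<Rightarrow>\<^sub>0 complex) \<Rightarrow> (nat list \<Rightarrow>\<^sub>0 complex)" where
  "witt i = lin_ext (witt_word i)"

lemma witt_linear: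
  "witt i (s + t) = witt i s + witt i t" "witt i (s - t) = witt i s - witt i t"
  "witt i (b *\<^sub>C t) = b *\<^sub>C witt i t" "witt i 0 = 0"
  by (simp_all add: witt_def lin_ext_add lin_ext_diff lin_ext_scale lin_ext_zero)

lemma single_scale: "Poly_Mapping.single w b = b *\<^sub>C Poly_Mapping.single w (1 :: complex)"
  by (simp add: scaleC_single scaleC_complex_def)

lemma free_word_induct [case_names base add scale]:
  assumes "\<And>w. P (Poly_Mapping.single w 1)" "\<And>s t. P s \<Longrightarrow> P t \<Longrightarrow> P (s + t)" "\<And>b t. P t \<Longrightarrow> P (b *\<^sub>C t)"
  shows "P (t :: 'k \<Rightarrow>\<^sub>0 complex)"
proof (induction t rule: poly_mapping_add_induct)
  case (single w b)
  show ?case by (subst single_scale) (intro assms)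
qed (rule assms)

lemma witt_single: "witt i (Poly_Mapping.single w 1) = witt_word i w"
  by (simp add: witt_def lin_ext_single scaleC_one)

lemma witt_neg_single: "i < 0 \<Longrightarrow> witt i (Poly_Mapping.single w 1) = Poly_Mapping.single (nat (-1 - i) # w) 1"
  by (cases w) (simp_all add: witt_single)

lemma witt_prepend: "lin_ext (\<lambda>w. Poly_Mapping.single (k # w) 1) t = witt (-1 - int k) t"
  by (induction t rule: free_word_induct)
    (simp_all add: lin_ext_single scaleC_one witt_neg_single lin_ext_add lin_ext_scale witt_linear)

lemma witt_commute_neg:
  assumes "0 \<le> i" "j < 0"
  shows "witt i (witt j t) = witt j (witt i t) + of_int (j - i) *\<^sub>C witt (i + j) t"
proof (induction t rule: free_word_induct)
  case (base w)
  have "- 1 - int (nat (- 1 - j)) = j" "i - 1 - int (nat (- 1 - j)) = i + j"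
    using assms by auto
  then show ?case
    using assms by (simp add: witt_neg_single) (simp add: witt_single witt_prepend)
next
  case (add s t)
  then show ?case
    by (simp add: witt_linear scaleC_add_right)
next
  case (scale b t)
  then show ?case
    by (simp only: witt_linear scaleC_add_right scaleC_scaleC mult.commute)
qed

text \<open>The failure of the Witt relation for \<open>i\<close> and \<open>j\<close>. It vanishes unless both indices are negative
  (\<open>defect_mixed\<close>, \<open>defect_nonneg\<close>).\<close>

definition defect :: "int \<Rightarrow> int \<Rightarrow> (nat list \<Rightarrow>\<^sub>0 complex) \<Rightarrow> (nat list \<Rightarrow>\<^sub>0 complex)" where
  "defect i j t = witt i (witt j t) - witt j (witt i t) - of_int (j - i) *\<^sub>C witt (i + j) t"

lemma defect_linear:
  "defect i j (s + t) = defect i j s + defect i j t"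
  "defect i j (b *\<^sub>C t) = b *\<^sub>C defect i j t" "defect i j 0 = 0"
  by (simp_all add: defect_def witt_linear scaleC_add_right cvs.scale_right_diff_distrib
      scaleC_scaleC mult.commute)

lemma witt_eq_defect:
  "witt i (witt j t) = witt j (witt i t) + of_int (j - i) *\<^sub>C witt (i + j) t + defect i j t"
  by (simp add: defect_def)

lemma defect_swap: "defect i j t = - defect j i t"
proof -
  have "of_int (i - j) *\<^sub>C witt (j + i) t = - (of_int (j - i) *\<^sub>C witt (i + j) t)"
    by (simp add: add.commute flip: cvs.scale_minus_left)
  then show ?thesis by (simp add: defect_def)
qed

lemma defect_mixed: "0 \<le> i \<Longrightarrow> j < 0 \<Longrightarrow> defect i j t = 0"
  by (simp add: defect_def witt_commute_neg)

text \<open>Expanding the commutator of \<open>L\<^sub>n\<close> with the defect of \<open>i\<close> and \<open>j\<close>. Every term is a defect except for multiples of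
  \<open>L\<^sub>n\<^sub>+\<^sub>i\<^sub>+\<^sub>j\<close>, whose coefficients add up to zero by the Jacobi identity of the Witt algebra.\<close>

lemma jacobi_defect:
  "witt n (defect i j t) = defect i j (witt n t)
     + of_int (i - n) *\<^sub>C defect (i + n) j t + of_int (j - n) *\<^sub>C defect i (j + n) t
     + (defect n i (witt j t) + witt i (defect n j t) - defect n j (witt i t) - witt j (defect n i t)
        - of_int (j - i) *\<^sub>C defect n (i + j) t)"
proof -
  let ?z = "witt (n + i + j) t"
  have "of_int ((i - n) * (j - (n + i))) + of_int ((j - n) * (j + n - i)) - of_int ((j - i) * (i + j - n)) = (0::complex)"
    by (simp flip: of_int_add of_int_diff add: algebra_simps)
  then have "(of_int ((i - n) * (j - (n + i))) + of_int ((j - n) * (j + n - i)) - of_int ((j - i) * (i + j - n))) *\<^sub>C ?z = 0"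
    by simp
  then have "of_int (i - n) *\<^sub>C of_int (j - (n + i)) *\<^sub>C ?z + of_int (j - n) *\<^sub>C of_int (j + n - i) *\<^sub>C ?z
     - of_int (j - i) *\<^sub>C of_int (i + j - n) *\<^sub>C ?z = 0"
    by (simp only: of_int_mult scaleC_scaleC scaleC_add_left cvs.scale_left_diff_distrib)
  then show ?thesis
    unfolding defect_def
    by (simp only: witt_linear cvs.scale_right_diff_distrib) (simp add: algebra_simps del: of_int_diff of_int_add)
qed

text \<open>Induction on the word. On a word with first letter \<open>m\<close>, which is \<open>L\<^sub>m\<close> applied to a shorter
  word, the Jacobi expansion reduces the claim to defects on the shorter word in which at least one index
  is nonnegative.\<close>

lemma defect_nonneg:
  assumes "0 \<le> i" "0 \<le> j"
  shows "defect i j t = 0"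
proof (induction t rule: free_word_induct)
  case (base w)
  show ?case using assms
  proof (induction w arbitrary: i j)
    case Nil
    then show ?case by (simp add: defect_def witt_single witt_linear)
  next
    case (Cons k w)
    define m where "m = -1 - int k"
    define s where "s = Poly_Mapping.single w (1 :: complex)"
    have m: "m < 0" "Poly_Mapping.single (k # w) 1 = witt m s"
      by (simp_all add: m_def s_def witt_neg_single)
    have IH: "defect p q s = 0" if "0 \<le> p \<or> 0 \<le> q" for p q
      using Cons(1)[of p q] that defect_mixed[of p q s] defect_mixed[of q p s] defect_swap[of p q s]
      by (cases "0 \<le> p"; cases "0 \<le> q") (auto simp: s_def)
    have "defect i j (witt m s) = witt m (defect i j s)"
      using jacobi_defect[of m i j s] Cons(2,3) m(1)
      by (simp add: IH defect_swap[of m] defect_mixed witt_linear)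
    then show ?case using Cons(2,3) by (simp add: m(2) IH witt_linear)
  qed
qed (simp_all add: defect_linear)

text \<open>The submodule generated by the defects. By \<open>witt_defects\<close> it suffices to close under negative generators.\<close>

inductive_set defects :: "(nat list \<Rightarrow>\<^sub>0 complex) set" where
  zero: "0 \<in> defects"
| add: "s \<in> defects \<Longrightarrow> t \<in> defects \<Longrightarrow> s + t \<in> defects"
| base: "i < 0 \<Longrightarrow> j < 0 \<Longrightarrow> defect i j t \<in> defects"
| left: "s \<in> defects \<Longrightarrow> i < 0 \<Longrightarrow> witt i s \<in> defects"

lemma defects_scale: "s \<in> defects \<Longrightarrow> b *\<^sub>C s \<in> defects"
  by (induction rule: defects.induct)
    (auto simp: scaleC_add_right intro: defects.intros simp flip: defect_linear(2) witt_linear(3))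

lemma subspace_defects: "cvs.subspace defects"
  by (auto simp: cvs.subspace_def intro: defects.intros defects_scale)

lemma defect_in_defects: "defect i j t \<in> defects"
proof -
  have "defect i j t = 0" if "\<not> (i < 0 \<and> j < 0)"
    using that defect_nonneg[of i j t] defect_mixed[of i j t] defect_mixed[of j i t] defect_swap[of i j t]
    by (cases "i < 0"; cases "j < 0") auto
  then show ?thesis using defects.base[of i j t] defects.zero by (cases "i < 0 \<and> j < 0") auto
qed

text \<open>Commuting a nonnegative \<open>L\<^sub>n\<close> past the defect of two negative indices leaves defects of shifted
  indices, which vanish or have negative indices again.\<close>

lemma witt_defects: "s \<in> defects \<Longrightarrow> witt n s \<in> defects"
proof (induction arbitrary: n rule: defects.induct)
  case zero
  then show ?case by (simp add: witt_linear defects.zero)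
next
  case (add s t)
  then show ?case by (simp add: witt_linear defects.add)
next
  case (base i j t)
  show ?case
  proof (cases "n < 0")
    case True
    then show ?thesis using base by (simp add: defects.left defects.base)
  next
    case False
    then have "defect n p r = 0" if "p < 0" for p r
      using defect_mixed that by simp
    then have "witt n (defect i j t) = defect i j (witt n t)
     + of_int (i - n) *\<^sub>C defect (i + n) j t + of_int (j - n) *\<^sub>C defect i (j + n) t"
      using base jacobi_defect[of n i j t] by (simp add: witt_linear)
    then show ?thesis
      by (simp only:) (intro defects.add defects_scale defect_in_defects)
  qed
next
  case (left s i)
  then show ?case
    unfolding witt_eq_defect[of n i s]
    by (intro defects.add defects_scale defect_in_defects) (auto intro: defects.left)
qed

lemma lookup_witt_neg:
  assumes "i < 0"
  shows "Poly_Mapping.lookup (witt i t) [] = 0"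
    "Poly_Mapping.lookup (witt i t) [0] = (if i = -1 then Poly_Mapping.lookup t [] else 0)"
proof (induction t rule: free_word_induct)
  case (base w)
  {
    case 1 show ?case using assms by (simp add: witt_neg_single lookup_single)
  next
    case 2 show ?case using assms by (auto simp: witt_neg_single lookup_single when_def)
  }
qed (simp_all add: witt_linear lookup_add scaleC_poly_mapping.rep_eq)

text \<open>The reason why the quotient does not collapse: a relation between two distinct negative
  generators involves words of length at least two and a single letter \<open>L\<^sub>i\<^sub>+\<^sub>j\<close> with \<open>i + j < - 1\<close>. So the words
  \<open>[]\<close> and \<open>[0]\<close> never occur in it, nor in anything obtained from it by prepending letters.\<close>

lemma lookup_defects:
  "s \<in> defects \<Longrightarrow> Poly_Mapping.lookup s [] = 0 \<and> Poly_Mapping.lookup s [0] = 0"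
proof (induction rule: defects.induct)
  case (base i j t)
  then show ?case
    by (simp add: defect_def lookup_minus scaleC_poly_mapping.rep_eq lookup_witt_neg)
qed (auto simp: lookup_add lookup_witt_neg)

definition witt_act :: "vir \<Rightarrow> (nat list \<Rightarrow>\<^sub>0 complex) \<Rightarrow> (nat list \<Rightarrow>\<^sub>0 complex)" where
  "witt_act x t = lin_ext (\<lambda>i. witt i t) (Lpart x)"

lemma witt_act_linear:
  "witt_act (x + y) t = witt_act x t + witt_act y t"
  "witt_act (b *\<^sub>C x) t = b *\<^sub>C witt_act x t"
  "witt_act x (s + t) = witt_act x s + witt_act x t"
  "witt_act x (b *\<^sub>C t) = b *\<^sub>C witt_act x t"
  "witt_act 0 t = 0"
  by (simp_all add: witt_act_def lin_ext_add lin_ext_scale lin_ext_zero witt_linear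
      lin_ext_fun_add lin_ext_fun_scale)

lemma witt_act_basis: "witt_act (vL i) = witt i" "witt_act vC t = 0"
  by (simp_all add: witt_act_def fun_eq_iff lin_ext_single lin_ext_zero scaleC_one)

lemma quotient_rep_witt: "quotient_rep witt_act defects"
proof
  fix x y :: vir and b t
  show "cvs.subspace defects" by (rule subspace_defects)
  show "witt_act x t \<in> defects" if "t \<in> defects"
    by (induction x rule: vir_induct)
      (simp_all add: witt_act_linear witt_act_basis that defects.zero defects.add defects_scale witt_defects)
  have 0: "witt_act x 0 = 0" for x
    using witt_act_linear(4)[of x 0 0] by simp
  show "witt_act (lie_bracket x y) t - (witt_act x (witt_act y t) - witt_act y (witt_act x t)) \<in> defects"
    (is "?f x y \<in> _")
  proof (induction x rule: vir_induct)
    case (L b i)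
    show ?case
    proof (induction y rule: vir_induct)
      case (L b' j)
      have "witt_act (lie_bracket (vL i) (vL j)) t = of_int (j - i) *\<^sub>C witt (i + j) t"
        by (simp add: vir_bracket_basis witt_act_linear witt_act_basis add.commute)
      then have "?f (vL i) (vL j) = (-1) *\<^sub>C defect i j t"
        by (simp add: witt_act_basis defect_def)
      moreover have "?f (b *\<^sub>C vL i) (b' *\<^sub>C vL j) = (b * b') *\<^sub>C ?f (vL i) (vL j)"
        by (simp add: vir_bracket_bilinear witt_act_linear cvs.scale_right_diff_distrib
            scaleC_scaleC mult.commute)
      ultimately show ?case
        by (simp only: defects_scale defect_in_defects)
    next
      case (C b')
      then show ?case
        by (simp add: vir_bracket_bilinear vir_bracket_basis witt_act_linear witt_act_basis 0 defects.zero)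
    next
      case (add y y')
      have "?f (b *\<^sub>C vL i) (y + y') = ?f (b *\<^sub>C vL i) y + ?f (b *\<^sub>C vL i) y'"
        by (simp add: vir_bracket_bilinear witt_act_linear scaleC_add_right)
      then show ?case using add by (simp only: defects.add)
    qed
  next
    case (C b)
    then show ?case
      by (simp add: vir_bracket_bilinear vir_bracket_basis witt_act_linear witt_act_basis 0 defects.zero)
  next
    case (add x x')
    have "?f (x + x') y = ?f x y + ?f x' y"
      by (simp add: vir_bracket_bilinear witt_act_linear)
    then show ?case using add by (simp only: defects.add)
  qed
qed (simp_all add: witt_act_linear defects.zero)

section \<open>Verma modules as highest weight representations\<close>

lemma quotient_rep_tensor:
  fixes B :: "'g::complex_lie_algebra set" and \<rho> :: "'g \<Rightarrow> 'w::complex_vs \<Rightarrow> 'w"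
  shows "quotient_rep tensor_act (cvs.span (tensor_relations B \<rho>))"
proof (rule quotient_rep.intro)
  show "cvs.subspace (cvs.span (tensor_relations B \<rho>))" by (rule cvs.subspace_span)
qed (simp_all add: tensor_act_add tensor_act_scale tensor_act_span tensor_act_rel)

lemma uea_induct [case_names one mult add scale]:
  assumes one: "P 1" and mult: "\<And>x u. P u \<Longrightarrow> P (uea_inj x * u)"
    and add: "\<And>u u'. P u \<Longrightarrow> P u' \<Longrightarrow> P (u + u')" and scale: "\<And>b u. P u \<Longrightarrow> P (b *\<^sub>C u)"
  shows "P (u :: 'g::complex_lie_algebra uea)"
proof -
  have "P (abs_uea p)" for p :: "'g free_alg"
  proof (induction p rule: poly_mapping_add_induct)
    case (single k b)
    have "P (abs_uea (Poly_Mapping.single (Fword xs) 1))" for xs :: "'g list"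
    proof (induction xs)
      case Nil
      then show ?case using one by (simp add: one_uea.abs_eq zero_fword_def[symmetric])
    next
      case (Cons x xs)
      have "Poly_Mapping.single (Fword (x # xs)) 1 = free_gen x * Poly_Mapping.single (Fword xs) 1"
        by (simp add: free_gen_def mult_single)
      then have "abs_uea (Poly_Mapping.single (Fword (x # xs)) 1)
          = uea_inj x * abs_uea (Poly_Mapping.single (Fword xs) 1)"
        by (simp add: times_uea.abs_eq uea_inj.abs_eq)
      then show ?case using mult[OF Cons] by simp
    qed
    then have "P (b *\<^sub>C abs_uea (Poly_Mapping.single k 1))" by (cases k) (auto intro: scale)
    then show ?case by (simp add: scaleC_uea.abs_eq scaleC_single scaleC_complex_def)
  next
    case (add p q)
    then show ?case using assms(3) by (metis plus_uea.abs_eq)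
  qed
  then show ?thesis using Quotient3_abs_rep[OF Quotient3_uea, of u] by metis
qed

lemma vir_nonneg_induct [consumes 1, case_names L C add scale zero]:
  assumes "x \<in> vir_nonneg" and L: "\<And>i. 0 \<le> i \<Longrightarrow> P (vL i)" and C: "P vC"
    and add: "\<And>x y. P x \<Longrightarrow> P y \<Longrightarrow> P (x + y)" and scale: "\<And>b x. P x \<Longrightarrow> P (b *\<^sub>C x)" and zero: "P 0"
  shows "P x"
  using assms(1) unfolding vir_nonneg_def
proof (induction rule: cvs.span_induct_alt)
  case (step b x y)
  then have "P x" using L C by auto
  then show ?case using step add scale by blast
qed (rule zero)

abbreviation verma_null :: "complex \<Rightarrow> complex \<Rightarrow> (vir uea \<times> complex \<Rightarrow>\<^sub>0 complex) set" where
  "verma_null h c \<equiv> cvs.span (tensor_relations vir_nonneg (hw_act h c))"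

abbreviation verma_rep_hw :: "vir uea \<times> complex \<Rightarrow>\<^sub>0 complex" where
  "verma_rep_hw \<equiv> tensor_gen 1 1"

text \<open>Cyclicity: the vectors \<open>u \<otimes> 1\<close> are obtained from \<open>1 \<otimes> 1\<close> by applying Lie algebra elements and
  taking linear combinations, and \<open>u \<otimes> w = w (u \<otimes> 1)\<close> because the inducing module is one-dimensional.\<close>

lemma highest_weight_rep_verma:
  "highest_weight_rep tensor_act (verma_null h c) h c verma_rep_hw"
proof -
  let ?N = "verma_null h c"
  interpret V: quotient_rep tensor_act ?N by (rule quotient_rep_tensor)
  note eq = verma_def verma_hw_def induced_module_simps coset_eq_iff[OF V.subspace_K]
  show ?thesis
  proof
    show "tensor_act (vL 0) verma_rep_hw - h *\<^sub>C verma_rep_hw \<in> ?N"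
      using verma_hw_relations(2)[of h c] by (simp add: eq)
    show "tensor_act vC verma_rep_hw - c *\<^sub>C verma_rep_hw \<in> ?N"
      using verma_hw_relations(3)[of h c] by (simp add: eq)
    show "tensor_act (vL i) verma_rep_hw \<in> ?N" if "0 < i" for i
      using verma_hw_relations(4)[OF that, of h c] by (simp add: eq)
    fix A
    assume A: "cvs.subspace A" "?N \<subseteq> A" "verma_rep_hw \<in> A"
      and act: "\<And>x t. t \<in> A \<Longrightarrow> tensor_act x t \<in> A"
    note rel = tensor_gen_rel[where B = vir_nonneg and \<rho> = "hw_act h c"]
    have gen: "tensor_gen u 1 \<in> A" for u
    proof (induction u rule: uea_induct)
      case one
      then show ?case using A(3) .
    next
      case (mult x u)
      then show ?case using act[of "tensor_gen u 1" x] by (simp add: tensor_act_gen)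
    next
      case (add u u')
      have "V.eqv (tensor_gen (u + u') 1) (tensor_gen u 1 + tensor_gen u' 1)"
        using rel(1)[of u u' 1] by (simp add: V.eqv_def diff_diff_add)
      then show ?case by (rule V.subspace_eqv[OF A(1,2)]) (intro cvs.subspace_add[OF A(1)] add)
    next
      case (scale b u)
      have "V.eqv (tensor_gen (b *\<^sub>C u) 1) (b *\<^sub>C tensor_gen u 1)"
        using rel(2)[of b u 1] by (simp add: V.eqv_def)
      then show ?case by (rule V.subspace_eqv[OF A(1,2)]) (intro cvs.subspace_scale[OF A(1)] scale)
    qed
    have "t \<in> A" for t
    proof (induction t rule: poly_mapping_add_induct)
      case (single k b)
      have k: "Poly_Mapping.single k b = b *\<^sub>C tensor_gen (fst k) (snd k)"
        by (simp add: tensor_gen_def scaleC_single scaleC_complex_def)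
      have "V.eqv (tensor_gen (fst k) (snd k)) (snd k *\<^sub>C tensor_gen (fst k) 1)"
        using rel(3)[of "fst k" "snd k" 1] by (simp add: V.eqv_def scaleC_complex_def)
      then have "tensor_gen (fst k) (snd k) \<in> A"
        by (rule V.subspace_eqv[OF A(1,2)]) (intro cvs.subspace_scale[OF A(1)] gen)
      then show ?case unfolding k by (rule cvs.subspace_scale[OF A(1)])
    next
      case (add p q)
      then show ?case by (rule cvs.subspace_add[OF A(1)])
    qed
    then show "A = UNIV" by blast
  qed
qed

text \<open>The universal property gives a homomorphism from \<open>M(0,0)\<close> to the module on words modulo
  defects, where \<open>v\<^sub>0\<close> goes to the empty word and \<open>L\<^sub>-\<^sub>1 v\<^sub>0\<close> to the word \<open>[0]\<close>, which is not a combination of defects.\<close>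

lemma verma_0_0_lower: "tensor_act (vL (- 1)) verma_rep_hw \<notin> verma_null 0 0"
proof
  assume *: "tensor_act (vL (- 1)) verma_rep_hw \<in> verma_null 0 0"
  interpret witt: quotient_rep witt_act defects by (rule quotient_rep_witt)
  define vac :: "nat list \<Rightarrow>\<^sub>0 complex" where "vac = Poly_Mapping.single [] 1"
  define f :: "complex \<Rightarrow> nat list \<Rightarrow>\<^sub>0 complex" where "f w = w *\<^sub>C vac" for w
  have vac: "witt_act x vac = 0" if "x \<in> vir_nonneg" for x
    using that
    by (induction rule: vir_nonneg_induct)
      (simp_all add: witt_act_linear witt_act_basis vac_def witt_single)
  have "witt.induced_map f (tensor_act (vL (- 1)) verma_rep_hw) \<in> defects"
  proof (rule witt.induced_map_relations[OF _ _ _ *])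
    show "f (w + w') = f w + f w'" for w w' by (simp add: f_def scaleC_add_left)
    show "f (b *\<^sub>C w) = b *\<^sub>C f w" for b w by (simp add: f_def scaleC_scaleC scaleC_complex_def)
    show "witt.eqv (witt_act b (f w)) (f (hw_act 0 0 b w))" if "b \<in> vir_nonneg" for b w
      using vac[OF that] by (simp add: f_def witt_act_linear hw_act_def)
  qed
  then have "witt.eqv (witt.induced_map f (tensor_act (vL (- 1)) verma_rep_hw)) 0"
    by (simp add: witt.eqv_0_iff)
  then have "witt.eqv 0 (witt.induced_map f (tensor_act (vL (- 1)) verma_rep_hw))"
    by (rule witt.eqv_sym)
  also have "witt.eqv \<dots> (witt_act (vL (- 1)) (witt.induced_map f verma_rep_hw))"
    by (rule witt.induced_map_act)
  also have "witt.eqv \<dots> (witt_act (vL (- 1)) vac)"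
    unfolding witt.induced_map_gen using witt.uea_act_one[of vac]
    by (intro witt.eqv_act) (simp add: f_def scaleC_one)
  finally have "witt.eqv 0 (Poly_Mapping.single [0] 1)"
    by (simp add: witt_act_basis vac_def witt_neg_single)
  then have "witt.eqv (Poly_Mapping.single [0] 1) 0" by (rule witt.eqv_sym)
  then show False using lookup_defects[of "Poly_Mapping.single [0] 1"] by (simp add: witt.eqv_0_iff)
qed

lemma quotient_rep_twisted:
  assumes "quotient_rep act K" "one_diff_operator d"
  shows "quotient_rep (\<lambda>x. act (d x + x)) K"
proof -
  interpret quotient_rep act K by fact
  interpret d: Vector_Spaces.linear scaleC scaleC d using assms(2) by (simp add: one_diff_operator_def)
  have bracket: "d (lie_bracket x y) + lie_bracket x y = lie_bracket (d x + x) (d y + y)" for x y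
    using assms(2) by (simp add: one_diff_operator_def lie_bracket_add_left lie_bracket_add_right)
  have add: "d (x + y) + (x + y) = (d x + x) + (d y + y)" for x y by (simp add: d.add)
  have scale: "d (b *\<^sub>C x) + b *\<^sub>C x = b *\<^sub>C (d x + x)" for b x by (simp add: d.scale scaleC_add_right)
  show ?thesis
  proof (rule quotient_rep.intro)
    fix x y b s t
    show "act (d (x + y) + (x + y)) t - (act (d x + x) t + act (d y + y) t) \<in> K"
      unfolding add by (rule add_act)
    show "act (d (b *\<^sub>C x) + b *\<^sub>C x) t - b *\<^sub>C act (d x + x) t \<in> K"
      unfolding scale by (rule scale_act)
    show "act (d (lie_bracket x y) + lie_bracket x y) t
        - (act (d x + x) (act (d y + y) t) - act (d y + y) (act (d x + x) t)) \<in> K"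
      unfolding bracket by (rule bracket_act)
  qed (rule subspace_K act_add act_scale act_K; assumption)+
qed

lemma hw_act_linear:
  "hw_act h c (x + y) 1 = hw_act h c x 1 + hw_act h c y 1"
  "hw_act h c (b *\<^sub>C x) 1 = b * hw_act h c x 1"
  "hw_act h c x w = w * hw_act h c x 1"
  by (simp_all add: hw_act_def lookup_add scaleC_poly_mapping.rep_eq scaleC_complex_def distrib_left
      distrib_right mult.assoc mult.left_commute mult.commute)

text \<open>The universal property of the Verma module, applied to the Verma module with the action
  twisted by \<open>d + id\<close>. The hypotheses on \<open>u\<close> say that the twisted action of the upper triangular part
  on \<open>u\<close> agrees with its action on the highest weight vector.\<close>

lemma twisted_endo_exists:
  fixes h c a :: complex and n :: int
  defines "K \<equiv> verma_null h c"
  assumes na: "n \<noteq> 0" "a \<noteq> 0" and c: "(of_int n - 1) * c = 0"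
    and weight: "tensor_act (vL 0) u - (of_int n * h) *\<^sub>C u \<in> K"
    and singular: "\<And>j. 0 < j \<Longrightarrow> tensor_act (vL (n * j)) u \<in> K"
  obtains \<phi> where "twisted_endo tensor_act K h c verma_rep_hw n a \<phi>" "\<phi> verma_rep_hw - u \<in> K"
proof -
  interpret V: highest_weight_rep tensor_act K h c verma_rep_hw
    unfolding K_def by (rule highest_weight_rep_verma)
  interpret T: quotient_rep "\<lambda>x. tensor_act (d_vir n a x + x)" K
    by (rule quotient_rep_twisted[OF V.quotient_rep_axioms d_vir_one_diff_operator[OF na]])
  define f where "f w = w *\<^sub>C u" for w
  let ?\<phi> = "T.induced_map f"
  have "V.eqv (tensor_act (d_vir n a b + b) u) (hw_act h c b 1 *\<^sub>C u)" if "b \<in> vir_nonneg" for b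
    using that
  proof (induction rule: vir_nonneg_induct)
    case (L i)
    show ?case
    proof (cases "i = 0")
      case True
      have "V.eqv (tensor_act (d_vir n a (vL 0) + vL 0) u) ((1 / of_int n) *\<^sub>C tensor_act (vL 0) u)"
        by (rule V.twisted_L0_act[OF c])
      also have "V.eqv \<dots> ((1 / of_int n) *\<^sub>C (of_int n * h) *\<^sub>C u)"
        by (intro V.eqv_scale) (simp add: V.eqv_def weight)
      finally show ?thesis using True na by (simp add: hw_act_def scaleC_scaleC)
    next
      case False
      have "V.eqv (tensor_act (d_vir n a (vL i) + vL i) u) ((a powi i / of_int n) *\<^sub>C tensor_act (vL (n * i)) u)"
        by (rule V.twisted_L_act_nonzero[OF False])
      also have "V.eqv \<dots> ((a powi i / of_int n) *\<^sub>C 0)"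
        using L False by (intro V.eqv_scale) (simp add: V.eqv_0_iff singular)
      finally show ?thesis using False by (simp add: hw_act_def lookup_single)
    qed
  next
    case C
    have "of_int n * c = (of_int n - 1) * c + c" by (simp only: left_diff_distrib) simp
    also have "\<dots> = hw_act h c vC 1" unfolding c by (simp add: hw_act_def)
    finally show ?case using V.twisted_C_act[of n a u] by (simp only:)
  next
    case (add x y)
    have "V.eqv (tensor_act (d_vir n a (x + y) + (x + y)) u)
        (tensor_act (d_vir n a x + x) u + tensor_act (d_vir n a y + y) u)"
      by (rule T.eqv_add_act)
    also have "V.eqv \<dots> (hw_act h c x 1 *\<^sub>C u + hw_act h c y 1 *\<^sub>C u)" by (intro V.eqv_add add)
    finally show ?case by (simp only: hw_act_linear(1) scaleC_add_left)
  next
    case (scale b x)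
    have "V.eqv (tensor_act (d_vir n a (b *\<^sub>C x) + b *\<^sub>C x) u) (b *\<^sub>C tensor_act (d_vir n a x + x) u)"
      by (rule T.eqv_scale_act)
    also have "V.eqv \<dots> (b *\<^sub>C hw_act h c x 1 *\<^sub>C u)" by (intro V.eqv_scale scale)
    finally show ?case by (simp only: hw_act_linear(2) scaleC_scaleC)
  next
    case zero
    have "d_vir n a 0 = 0" using d_vir_scale[of n a 0 0] by simp
    then show ?case by (simp add: hw_act_def V.eqv_zero_act)
  qed
  then have f_act: "T.eqv (tensor_act (d_vir n a b + b) (f w)) (f (hw_act h c b w))" if "b \<in> vir_nonneg" for b w
    unfolding f_def V.act_scale hw_act_linear(3)[of h c b w] scaleC_scaleC[symmetric]
    using that by (intro V.eqv_scale)
  have \<phi>_K: "?\<phi> t \<in> K" if "t \<in> K" for t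
  proof (rule T.induced_map_relations)
    show "t \<in> cvs.span (tensor_relations vir_nonneg (hw_act h c))" using that by (simp add: K_def)
  qed (use f_act in \<open>simp_all add: f_def scaleC_add_left scaleC_scaleC scaleC_complex_def\<close>)
  show ?thesis
  proof
    show "twisted_endo tensor_act K h c verma_rep_hw n a ?\<phi>"
    proof
      show "?\<phi> (tensor_act x t) - tensor_act (d_vir n a x + x) (?\<phi> t) \<in> K" for x t
        using T.induced_map_act[of f x t] by (simp add: T.eqv_def)
    qed (use na \<phi>_K in \<open>simp_all add: T.induced_map_linear cvs.subspace_0[OF V.subspace_K]\<close>)
    show "?\<phi> verma_rep_hw - u \<in> K"
      using T.uea_act_one[of u] by (simp add: T.induced_map_gen f_def scaleC_one T.eqv_def)
  qed
qed

section \<open>Differential structures on Verma modules\<close>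

text \<open>\<open>\<tau>\<close> is a choice of representatives for \<open>\<delta> + id\<close>. It need not be linear, only linear modulo the relations.
  This locale translates statements about cosets into congruences between representatives.\<close>

locale verma_endo =
  fixes h c :: complex and \<delta> :: "verma_vec \<Rightarrow> verma_vec"
    and \<tau> :: "(vir uea \<times> complex \<Rightarrow>\<^sub>0 complex) \<Rightarrow> vir uea \<times> complex \<Rightarrow>\<^sub>0 complex"
  assumes linear: "mlinear_endo (verma h c) \<delta>"
    and lift: "\<delta> (coset (verma_null h c) t) = coset (verma_null h c) (\<tau> t - t)"
begin

abbreviation "K \<equiv> verma_null h c"
abbreviation "q \<equiv> coset K"

sublocale V: highest_weight_rep tensor_act K h c verma_rep_hw
  by (rule highest_weight_rep_verma)

notation V.eqv (infix "\<approx>" 50)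

lemma q_eq_iff: "q s = q t \<longleftrightarrow> s \<approx> t"
  by (simp add: V.eqv_def coset_eq_iff[OF V.subspace_K])

lemma verma_simps:
  "mcarrier (verma h c) = range q"
  "madd (verma h c) (q s) (q t) = q (s + t)"
  "mzero (verma h c) = q 0"
  "mscale (verma h c) b (q s) = q (b *\<^sub>C s)"
  "mact (verma h c) x (q s) = q (tensor_act x s)"
  "msub (verma h c) (q s) (q t) = q (s - t)"
  by (simp_all add: verma_def msub_def induced_module_simps)

lemma vL_word_q: "vL_word h c is (q t) = q (V.L_word is t)"
  unfolding vL_word_def V.L_word_def by (induction "is") (simp_all add: verma_simps)

lemma verma_hw_q: "verma_hw h c = q verma_rep_hw"
  by (simp add: verma_hw_def)

lemma verma_weight_q: "q t \<in> verma_weight h c z \<longleftrightarrow> tensor_act (vL 0) t \<approx> (h + z) *\<^sub>C t"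
  by (simp add: verma_weight_def verma_simps q_eq_iff V.C_act rangeI)

lemma lift_linear: "\<tau> (s + t) \<approx> \<tau> s + \<tau> t" "\<tau> (b *\<^sub>C t) \<approx> b *\<^sub>C \<tau> t"
proof -
  have "\<delta> (madd (verma h c) (q s) (q t)) = madd (verma h c) (\<delta> (q s)) (\<delta> (q t))"
    "\<delta> (mscale (verma h c) b (q t)) = mscale (verma h c) b (\<delta> (q t))"
    using linear by (simp_all add: mlinear_endo_def verma_simps(1))
  then show "\<tau> (s + t) \<approx> \<tau> s + \<tau> t" "\<tau> (b *\<^sub>C t) \<approx> b *\<^sub>C \<tau> t"
    by (simp_all add: verma_simps lift q_eq_iff V.eqv_def algebra_simps)
qed

lemma lift_K: "t \<in> K \<Longrightarrow> \<tau> t \<in> K"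
proof -
  assume t: "t \<in> K"
  then have "q t = q 0" by (simp add: q_eq_iff V.eqv_0_iff)
  then have "q (\<tau> t - t) = q (\<tau> 0 - 0)" using lift by metis
  then have "\<tau> t - t \<approx> \<tau> 0" by (simp add: q_eq_iff)
  also have "\<dots> \<approx> 0" using lift_linear(2)[of 0 0] by simp
  finally have "\<tau> t - t \<in> K" by (simp add: V.eqv_0_iff)
  then show ?thesis using t cvs.span_add by fastforce
qed

text \<open>Substituting \<open>\<delta> = \<tau> - id\<close>, all terms without \<open>\<tau>\<close> cancel.\<close>

lemma one_diff_module_iff:
  "one_diff_module d (verma h c) \<delta> \<longleftrightarrow>
    (\<forall>x t. \<tau> (tensor_act x t) \<approx> tensor_act (d x + x) (\<tau> t))"
proof -
  have "lie_module (verma h c)" unfolding verma_def by (rule lie_module_induced)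
  then have "one_diff_module d (verma h c) \<delta> \<longleftrightarrow>
    (\<forall>x t. \<tau> (tensor_act x t) - tensor_act x t \<approx>
       tensor_act (d x) t + tensor_act x (\<tau> t - t) + tensor_act (d x) (\<tau> t - t))"
    by (simp add: one_diff_module_def linear verma_simps lift q_eq_iff)
  also have "\<dots> \<longleftrightarrow> (\<forall>x t. \<tau> (tensor_act x t) \<approx> tensor_act (d x) (\<tau> t) + tensor_act x (\<tau> t))"
    by (simp add: V.eqv_def V.act_diff algebra_simps)
  also have "\<dots> \<longleftrightarrow> (\<forall>x t. \<tau> (tensor_act x t) \<approx> tensor_act (d x + x) (\<tau> t))"
    using V.eqv_add_act V.eqv_sym V.eqv_trans by meson
  finally show ?thesis .
qed

lemma trivial_iff: "trivial_one_diff (verma h c) \<delta> \<longleftrightarrow> (\<forall>t. \<tau> t \<approx> 0)"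
  by (simp add: trivial_one_diff_def verma_simps lift q_eq_iff V.eqv_def)

lemma n_singular_q:
  "n_singular n h c (q u) \<longleftrightarrow> \<not> u \<approx> 0 \<and> (\<exists>i::nat. tensor_act (vL 0) u \<approx> (h - of_nat i) *\<^sub>C u)
     \<and> (\<forall>j>0. tensor_act (vL (n * j)) u \<approx> 0)"
  by (simp add: n_singular_def verma_simps q_eq_iff verma_weight_q)

lemma formula_iff:
  "\<delta> (vL_word h c is (verma_hw h c)) =
     msub (verma h c) (mscale (verma h c) b (vL_word h c js (q u))) (vL_word h c is (verma_hw h c))
   \<longleftrightarrow> \<tau> (V.L_word is verma_rep_hw) \<approx> b *\<^sub>C V.L_word js u"
  by (simp add: verma_hw_q vL_word_q verma_simps lift q_eq_iff V.eqv_def)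

lemma twisted_endo_iff:
  assumes "n \<noteq> 0" "a \<noteq> 0"
  shows "twisted_endo tensor_act K h c verma_rep_hw n a \<tau> \<longleftrightarrow> one_diff_module (d_vir n a) (verma h c) \<delta>"
proof -
  have "twisted_endo_axioms tensor_act K n a \<tau> \<longleftrightarrow>
      (\<forall>x t. \<tau> (tensor_act x t) \<approx> tensor_act (d_vir n a x + x) (\<tau> t))"
    using assms lift_linear lift_K by (simp add: twisted_endo_axioms_def V.eqv_def)
  then show ?thesis
    using V.highest_weight_rep_axioms by (simp add: twisted_endo_def one_diff_module_iff)
qed

text \<open>The formula prescribes \<open>\<tau>\<close> on sorted words only. There it agrees with the twisted
  endomorphism obtained from the universal property, hence everywhere, because sorted words span.\<close>

lemma twisted_endo_of_formula:
  assumes na: "n \<noteq> 0" "a \<noteq> 0" and c: "(of_int n - 1) * c = 0"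
    and weight: "tensor_act (vL 0) u \<approx> (of_int n * h) *\<^sub>C u"
    and singular: "\<And>j. 0 < j \<Longrightarrow> tensor_act (vL (n * j)) u \<approx> 0"
    and formula: "\<And>is. neg_word is \<Longrightarrow> sorted is \<Longrightarrow> \<tau> (V.L_word is verma_rep_hw) \<approx>
      (a powi sum_list is / of_int n ^ length is) *\<^sub>C V.L_word (map (\<lambda>i. n * i) is) u"
  shows "twisted_endo tensor_act K h c verma_rep_hw n a \<tau>"
proof -
  obtain \<phi> where \<phi>: "twisted_endo tensor_act K h c verma_rep_hw n a \<phi>" "\<phi> verma_rep_hw - u \<in> K"
    by (rule twisted_endo_exists[where n = n and a = a and c = c and h = h and u = u]) (use na c weight singular in \<open>simp_all add: V.eqv_def\<close>)
  interpret P: twisted_endo tensor_act K h c verma_rep_hw n a \<phi> by fact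
  let ?A = "{t. \<tau> t \<approx> \<phi> t}"
  have sub: "cvs.subspace ?A"
    by (rule V.subspace_eqvs) (simp_all add: lift_linear P.eqv_twisted_add P.eqv_twisted_scale)
  have "V.L_word is verma_rep_hw \<in> ?A" if "neg_word is" "sorted is" for "is"
  proof -
    let ?b = "a powi sum_list is / of_int n ^ length is"
    have "\<tau> (V.L_word is verma_rep_hw) \<approx> ?b *\<^sub>C V.L_word (map (\<lambda>i. n * i) is) u"
      by (rule formula[OF that])
    also have "\<dots> \<approx> ?b *\<^sub>C V.L_word (map (\<lambda>i. n * i) is) (\<phi> verma_rep_hw)"
      using \<phi>(2) by (intro V.eqv_scale V.eqv_L_word V.eqv_sym[of _ u]) (simp add: V.eqv_def)
    also have "\<dots> \<approx> \<phi> (V.L_word is verma_rep_hw)"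
      by (rule V.eqv_sym[OF P.twisted_word[OF that(1)]])
    finally show ?thesis by simp
  qed
  moreover have "K \<subseteq> ?A"
    by (auto intro: V.eqv_K lift_K P.twisted_K)
  ultimately have "cvs.span ({V.L_word is verma_rep_hw | is. neg_word is \<and> sorted is} \<union> K) \<subseteq> ?A"
    by (intro cvs.span_minimal sub) blast
  then have eq: "\<tau> t \<approx> \<phi> t" for t
    unfolding V.sorted_words_span by blast
  show ?thesis
    unfolding twisted_endo_iff[OF na] one_diff_module_iff
  proof (intro allI)
    fix x t
    have "\<tau> (tensor_act x t) \<approx> \<phi> (tensor_act x t)" by (rule eq)
    also have "\<dots> \<approx> tensor_act (d_vir n a x + x) (\<phi> t)" by (rule P.eqv_twisted_act)
    also have "\<dots> \<approx> tensor_act (d_vir n a x + x) (\<tau> t)" by (intro V.eqv_act V.eqv_sym[OF eq])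
    finally show "\<tau> (tensor_act x t) \<approx> tensor_act (d_vir n a x + x) (\<tau> t)" .
  qed
qed

end

theorem theorem3p5:
  fixes n :: int and a h c :: complex and \<delta> :: "verma_vec \<Rightarrow> verma_vec"
  assumes "n \<noteq> 0" and "a \<noteq> 0" and "mlinear_endo (verma h c) \<delta>"
  shows "((one_diff_module (d_vir n a) (verma h c) \<delta> \<and> \<not> trivial_one_diff (verma h c) \<delta>) \<longleftrightarrow>
      (n > 0 \<and> (of_int n - 1) * c = 0 \<and> (1 - of_int n) * h \<in> \<nat> \<and>
       (\<exists>u. n_singular n h c u \<and> u \<in> verma_weight h c ((of_int n - 1) * h) \<and>
         (\<forall>is. sorted is \<and> (\<forall>i\<in>set is. i \<le> - 1) \<longrightarrow>
            \<delta> (vL_word h c is (verma_hw h c)) =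
              msub (verma h c)
                (mscale (verma h c) (a powi (sum_list is) / of_int n ^ length is)
                  (vL_word h c (map (\<lambda>i. n * i) is) u))
                (vL_word h c is (verma_hw h c)))))) \<and>
    (n = 1 \<and> one_diff_module (d_vir n a) (verma h c) \<delta> \<longrightarrow>
      (\<exists>\<xi>. \<forall>i::int. \<forall>v\<in>verma_weight h c (- of_int i).
         \<delta> v = mscale (verma h c) (\<xi> * a powi (- i) - 1) v))"
proof -
  let ?q = "coset (verma_null h c)"
  have "\<exists>s. \<delta> (?q t) = ?q (s - t)" for t
  proof -
    have "\<delta> (?q t) \<in> range ?q"
      using assms(3) by (auto simp: mlinear_endo_def verma_def induced_module_simps)
    then obtain s where "\<delta> (?q t) = ?q s" by blast
    then show ?thesis by (intro exI[of _ "s + t"]) simp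
  qed
  then obtain \<tau> where \<tau>: "\<And>t. \<delta> (?q t) = ?q (\<tau> t - t)" by metis
  interpret verma_endo h c \<delta> \<tau> by unfold_locales (use assms(3) \<tau> in auto)
  note endo_iff = twisted_endo_iff[OF assms(1,2)]
  have weight_eq: "h + (of_int n - 1) * h = of_int n * h" by (simp add: algebra_simps)
  have q_cases: "(\<exists>u. n_singular n h c u \<and> u \<in> verma_weight h c z \<and> P u) \<longleftrightarrow>
      (\<exists>u. n_singular n h c (q u) \<and> q u \<in> verma_weight h c z \<and> P (q u))" for z P
    by (auto simp: verma_weight_def verma_simps(1))
  show ?thesis
  proof (intro conjI iffI)
    assume *: "one_diff_module (d_vir n a) (verma h c) \<delta> \<and> \<not> trivial_one_diff (verma h c) \<delta>"
    interpret T: twisted_endo tensor_act K h c verma_rep_hw n a \<tau> using * endo_iff by blast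
    have nz: "\<not> \<tau> verma_rep_hw \<approx> 0" using * T.twisted_zero by (auto simp: trivial_iff)
    show "n > 0"
    proof (rule T.twisted_pos[OF nz])
      show "\<not> tensor_act (vL (- 1)) verma_rep_hw \<approx> 0" if "h = 0" "c = 0"
        using verma_0_0_lower that unfolding V.eqv_0_iff by simp
    qed
    show c: "(of_int n - 1) * c = 0" by (rule T.twisted_C[OF nz])
    show h: "(1 - of_int n) * h \<in> \<nat>" by (rule T.twisted_weight[OF nz])
    have L0: "tensor_act (vL 0) (\<tau> verma_rep_hw) \<approx> (of_int n * h) *\<^sub>C \<tau> verma_rep_hw"
      by (rule T.twisted_L0[OF c])
    obtain i :: nat where "(1 - of_int n) * h = of_nat i" using h by (rule Nats_cases)
    then have "h - of_nat i = of_int n * h" by (simp add: algebra_simps)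
    then have "n_singular n h c (q (\<tau> verma_rep_hw))"
      unfolding n_singular_q using nz L0 T.twisted_singular by metis
    moreover have "q (\<tau> verma_rep_hw) \<in> verma_weight h c ((of_int n - 1) * h)"
      using L0 by (simp only: verma_weight_q weight_eq)
    ultimately show "\<exists>u. n_singular n h c u \<and> u \<in> verma_weight h c ((of_int n - 1) * h) \<and>
         (\<forall>is. sorted is \<and> (\<forall>i\<in>set is. i \<le> - 1) \<longrightarrow>
            \<delta> (vL_word h c is (verma_hw h c)) =
              msub (verma h c)
                (mscale (verma h c) (a powi (sum_list is) / of_int n ^ length is)
                  (vL_word h c (map (\<lambda>i. n * i) is) u))
                (vL_word h c is (verma_hw h c)))"
      using T.twisted_word unfolding neg_word_def
      by (intro exI[of _ "q (\<tau> verma_rep_hw)"]) (simp only: formula_iff, blast)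
  next
    assume *: "n > 0 \<and> (of_int n - 1) * c = 0 \<and> (1 - of_int n) * h \<in> \<nat> \<and>
       (\<exists>u. n_singular n h c u \<and> u \<in> verma_weight h c ((of_int n - 1) * h) \<and>
         (\<forall>is. sorted is \<and> (\<forall>i\<in>set is. i \<le> - 1) \<longrightarrow>
            \<delta> (vL_word h c is (verma_hw h c)) =
              msub (verma h c)
                (mscale (verma h c) (a powi (sum_list is) / of_int n ^ length is)
                  (vL_word h c (map (\<lambda>i. n * i) is) u))
                (vL_word h c is (verma_hw h c))))"
    then obtain u where u: "n_singular n h c (q u)" "q u \<in> verma_weight h c ((of_int n - 1) * h)"
      and formula: "\<And>is. sorted is \<Longrightarrow> neg_word is \<Longrightarrow> \<tau> (V.L_word is verma_rep_hw) \<approx>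
        (a powi sum_list is / of_int n ^ length is) *\<^sub>C V.L_word (map (\<lambda>i. n * i) is) u"
      unfolding q_cases formula_iff neg_word_def by blast
    have "twisted_endo tensor_act K h c verma_rep_hw n a \<tau>"
    proof (rule twisted_endo_of_formula[OF assms(1,2)])
      show "tensor_act (vL 0) u \<approx> (of_int n * h) *\<^sub>C u"
        using u(2) by (simp only: verma_weight_q weight_eq)
    qed (use * u(1) formula in \<open>auto simp: n_singular_q\<close>)
    then show "one_diff_module (d_vir n a) (verma h c) \<delta>" using endo_iff by blast
    have "\<tau> verma_rep_hw \<approx> u" using formula[of "[]"] by simp
    then have "\<not> \<tau> verma_rep_hw \<approx> 0"
      using u(1) V.eqv_sym V.eqv_trans unfolding n_singular_q by blast
    then show "\<not> trivial_one_diff (verma h c) \<delta>" by (auto simp: trivial_iff)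
  next
    show "n = 1 \<and> one_diff_module (d_vir n a) (verma h c) \<delta> \<longrightarrow>
      (\<exists>\<xi>. \<forall>i::int. \<forall>v\<in>verma_weight h c (- of_int i).
         \<delta> v = mscale (verma h c) (\<xi> * a powi (- i) - 1) v)"
    proof (rule impI, elim conjE)
      assume n: "n = 1" and "one_diff_module (d_vir n a) (verma h c) \<delta>"
      then interpret T: twisted_endo tensor_act K h c verma_rep_hw n a \<tau> using endo_iff by blast
      obtain \<xi> where \<xi>: "\<And>i t. tensor_act (vL 0) t \<approx> (h - of_int i) *\<^sub>C t \<Longrightarrow> \<tau> t \<approx> (\<xi> * a powi (- i)) *\<^sub>C t"
        using T.twisted_one[OF n] by blast
      have "\<delta> v = mscale (verma h c) (\<xi> * a powi (- i) - 1) v" if v: "v \<in> verma_weight h c (- of_int i)" for i v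
      proof -
        obtain t where t: "v = q t" using v by (auto simp: verma_weight_def verma_simps(1))
        have "\<tau> t \<approx> (\<xi> * a powi (- i)) *\<^sub>C t"
          using v by (intro \<xi>) (simp add: t verma_weight_q)
        then show ?thesis
          by (simp add: t lift verma_simps q_eq_iff V.eqv_def cvs.scale_left_diff_distrib)
      qed
      then show "\<exists>\<xi>. \<forall>i::int. \<forall>v\<in>verma_weight h c (- of_int i).
         \<delta> v = mscale (verma h c) (\<xi> * a powi (- i) - 1) v"
        by blast
    qed
  qed
qed

end
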